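(* Let $\mathcal{G}=(V':V'',E)$ be a bipartite $\Delta$-regular undirected connected graph with $|V'|=|V''|=n>1$, let $F=\mathrm{GF}(q)$, let $\mathcal{C}'$ and $\mathcal{C}''$ be linear $[\Delta,r\Delta,\theta\Delta]$ and $[\Delta,R\Delta,\delta\Delta]$ codes over $F$, and let $\mathsf{C}=(\mathcal{G},\mathcal{C}':\mathcal{C}'')$, $\Phi=F^{r\Delta}$ and $(\mathsf{C})_\Phi$ be the associated code of length $n$ over $\Phi$. Suppose that $$\sqrt{\theta\delta}>2\gamma_{\mathcal{G}}>0,$$ and fix $\sigma$ to be a positive real number such that $$\sigma<\beta=\frac{(\delta/2)-\gamma_{\mathcal{G}}\sqrt{\delta/\theta}}{1-\gamma_{\mathcal{G}}}.$$ If $$\nu=2\left\lfloor\log\left(\frac{\beta\sqrt{\sigma n}-\sigma}{\beta-\sigma}\right)\right\rfloor+3,$$ where the base of the logarithm is $(\theta\delta)/(4\gamma_{\mathcal{G}}^2)$, then the iterative decoder for $(\mathsf{C})_\Phi$ described in the context, run with this $\nu$, recovers correctly any pattern of $t$ errors (over $\Phi$) and $\rho$ erasures, provided that $$t+\frac{\rho}{2}\le\sigma n.$$ That is, if $x\in(\mathsf{C})_\Phi$ and $y\in(\Phi\cup\{?\})^n$ is such that $y_u=\,?$ for exactly $\rho$ vertices $u\in V'$ and $y_u\in\Phi\setminus\{x_u\}$ for exactly $t$ vertices $u\in V'$, with $t+\rho/2\le\sigma n$, then the decoder on input $y$ outputs $x$.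
   Context: $V=V'\cup V''$ is the vertex set of $\mathcal{G}$, with $V'\cap V''=\emptyset$, and every edge has one endpoint in $V'$ and one in $V''$. For a vertex $u$, $E(u)$ is the set of edges incident with $u$; an ordering of $V$ is fixed, which induces an ordering of each $E(u)$. For a word $z=(z_e)_{e\in E}$, $(z)_{E(u)}$ denotes the sub-block of $z$ indexed by $E(u)$. The number $\gamma_{\mathcal{G}}$ is the ratio between the second largest eigenvalue of the 0/1 adjacency matrix of $\mathcal{G}$ and $\Delta$ (the largest eigenvalue); here $0\le\gamma_{\mathcal{G}}<1$. A linear $[N,k,d]$ code over $F$ is a $k$-dimensional subspace of $F^N$ with minimum Hamming distance $d$. The code $\mathsf{C}=(\mathcal{G},\mathcal{C}':\mathcal{C}'')$ is the set of all $c\in F^{|E|}$ with $(c)_{E(u)}\in\mathcal{C}'$ for every $u\in V'$ and $(c)_{E(v)}\in\mathcal{C}''$ for every $v\in V''$. Let $\Phi=F^{r\Delta}$, fix a linear one-to-one map $\mathcal{E}:\Phi\to\mathcal{C}'$ over $F$ (hence a bijection), and define $\psi_{\mathcal{E}}(c)=\bigl(\mathcal{E}^{-1}((c)_{E(u)})\bigr)_{u\in V'}\in\Phi^n$ for $c\in\mathsf{C}$. Then $(\mathsf{C})_\Phi=\{\psi_{\mathcal{E}}(c):c\in\mathsf{C}\}$. The symbol "$?$" denotes an erasure. Let $\mathcal{D}':F^\Delta\to\mathcal{C}'$ be a decoder that recovers correctly any pattern of fewer than $\theta\Delta/2$ errors (i.e. $\mathcal{D}'(w)=c$ whenever $c\in\mathcal{C}'$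 and $w$ differs from $c$ in fewer than $\theta\Delta/2$ positions). Let $\mathcal{D}'':(F\cup\{?\})^\Delta\to\mathcal{C}''$ be a decoder that recovers correctly any pattern of $a$ errors and $b$ erasures with $2a+b<\delta\Delta$ (i.e. $\mathcal{D}''(w)=c$ whenever $c\in\mathcal{C}''$, $w$ has exactly $b$ entries equal to $?$, and exactly $a$ non-erased entries of $w$ differ from those of $c$). Iterative decoder (with parameter $\nu$). Input: $y=(y_u)_{u\in V'}\in(\Phi\cup\{?\})^n$. Initialize a word $z=(z_e)_{e\in E}$ over $F\cup\{?\}$: for each $u\in V'$, set $(z)_{E(u)}\leftarrow\mathcal{E}(y_u)$ if $y_u\in\Phi$, and $(z)_{E(u)}\leftarrow\,??\cdots?$ if $y_u=\,?$. For $i=2,3,\dots,\nu$: if $i$ is odd, replace $(z)_{E(u)}\leftarrow\mathcal{D}'((z)_{E(u)})$ for every $u\in V'$; if $i$ is even, replace $(z)_{E(v)}\leftarrow\mathcal{D}''((z)_{E(v)})$ for every $v\in V''$. Output: $\psi_{\mathcal{E}}(z)$ if $z\in\mathsf{C}$; otherwise declare "error".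
   Formalization: The case of exactly one erasure and no errors (t=0, ρ=1) is claimed only when σn ≥ 1; if σn < 1 then ν ≤ 1 or the logarithm is undefined, so no iteration is run and the erasure cannot be filled. *)

theory Defs
  imports
    "Jordan_Normal_Form.Char_Poly"
    "Jordan_Normal_Form.VS_Connect"
    "HOL-Library.FuncSet"
begin

text \<open>
  A graph is given by its vertex set and its set \<open>E\<close> of edges, an edge being a two-element set of
  vertices.  The fixed ordering of the vertices is the order of the type \<open>'v::linorder\<close>.
\<close>

definition bipartite_graph :: "'v set \<Rightarrow> 'v set \<Rightarrow> 'v set set \<Rightarrow> bool" where
  "bipartite_graph V1 V2 E \<longleftrightarrow> finite V1 \<and> finite V2 \<and> V1 \<inter> V2 = {} \<and>
     (\<forall>e\<in>E. \<exists>u\<in>V1. \<exists>v\<in>V2. e = {u, v})"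

definition regular_graph :: "'v set \<Rightarrow> 'v set set \<Rightarrow> nat \<Rightarrow> bool" where
  "regular_graph V E \<Delta> \<longleftrightarrow> (\<forall>u\<in>V. card {e\<in>E. u \<in> e} = \<Delta>)"

definition connected_graph :: "'v set \<Rightarrow> 'v set set \<Rightarrow> bool" where
  "connected_graph V E \<longleftrightarrow> (\<forall>u\<in>V. \<forall>w\<in>V. (u, w) \<in> {(a, b). {a, b} \<in> E}\<^sup>*)"

definition adj_matrix :: "'v::linorder set \<Rightarrow> 'v set set \<Rightarrow> real mat" where
  "adj_matrix V E = mat (card V) (card V)
     (\<lambda>(i, j). if {sorted_list_of_set V ! i, sorted_list_of_set V ! j} \<in> E then 1 else 0)"

text \<open>
  All eigenvalues of the symmetric adjacency matrix are real; they are listed with multiplicity,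
  in nonincreasing order.
\<close>

definition graph_spectrum :: "'v::linorder set \<Rightarrow> 'v set set \<Rightarrow> real list" where
  "graph_spectrum V E = rev (sorted_list_of_multiset (proots (char_poly (adj_matrix V E))))"

definition graph_gamma :: "'v::linorder set \<Rightarrow> 'v set set \<Rightarrow> nat \<Rightarrow> real" where
  "graph_gamma V E \<Delta> = graph_spectrum V E ! 1 / real \<Delta>"


text \<open>The list of the edges in \<open>E(u)\<close>, each edge \<open>{u, w}\<close> being ordered by its other endpoint \<open>w\<close>.\<close>

definition edges_at :: "'v::linorder set set \<Rightarrow> 'v \<Rightarrow> 'v set list" where
  "edges_at E u = map (\<lambda>w. {u, w}) (sorted_list_of_set {w. {u, w} \<in> E})"

definition block :: "'v::linorder set set \<Rightarrow> ('v set \<Rightarrow> 'a) \<Rightarrow> 'v \<Rightarrow> 'a vec" where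
  "block E z u = vec_of_list (map z (edges_at E u))"

text \<open>
  If \<open>U\<close> is one side of a bipartite graph, every edge \<open>e\<close> has exactly one endpoint in \<open>U\<close>, and
  \<open>word_of_blocks E U b\<close> is the word over \<open>E\<close> whose block at \<open>u\<close> is \<open>b u\<close>, for all \<open>u \<in> U\<close>
  (see \<open>block_word_of_blocks\<close> below).  Words are extensional functions on \<open>E\<close>.
\<close>

definition word_of_blocks ::
  "'v::linorder set set \<Rightarrow> 'v set \<Rightarrow> ('v \<Rightarrow> 'a vec) \<Rightarrow> 'v set \<Rightarrow> 'a" where
  "word_of_blocks E U b = (\<lambda>e\<in>E.
     let u = (THE u. u \<in> U \<and> u \<in> e);
         i = (THE i. i < length (edges_at E u) \<and> edges_at E u ! i = e)
     in b u $ i)"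


definition hamming_dist :: "'a vec \<Rightarrow> 'a vec \<Rightarrow> nat" where
  "hamming_dist v w = card {i. i < dim_vec v \<and> v $ i \<noteq> w $ i}"

text \<open>
  A linear \<open>[N,k,d]\<close> code.  The minimum distance is required to be attained, so a code has at least
  two codewords.
\<close>

definition linear_code :: "nat \<Rightarrow> nat \<Rightarrow> nat \<Rightarrow> 'f::field vec set \<Rightarrow> bool" where
  "linear_code N k d C \<longleftrightarrow>
     VectorSpace.subspace class_ring C (module_vec TYPE('f) N) \<and>
     vectorspace.dim class_ring ((module_vec TYPE('f) N)\<lparr>carrier := C\<rparr>) = k \<and>
     (\<exists>c\<in>C. \<exists>c'\<in>C. c \<noteq> c' \<and> hamming_dist c c' = d) \<and>
     (\<forall>c\<in>C. \<forall>c'\<in>C. c \<noteq> c' \<longrightarrow> d \<le> hamming_dist c c')"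

definition linear_encoder :: "nat \<Rightarrow> nat \<Rightarrow> 'f::field vec set \<Rightarrow> ('f vec \<Rightarrow> 'f vec) \<Rightarrow> bool" where
  "linear_encoder k N C enc \<longleftrightarrow>
     linear_map class_ring (module_vec TYPE('f) k) ((module_vec TYPE('f) N)\<lparr>carrier := C\<rparr>) enc \<and>
     inj_on enc (carrier_vec k)"

definition graph_code ::
  "'v::linorder set \<Rightarrow> 'v set \<Rightarrow> 'v set set \<Rightarrow> 'f vec set \<Rightarrow> 'f vec set \<Rightarrow> ('v set \<Rightarrow> 'f) set" where
  "graph_code V1 V2 E C1 C2 = {c \<in> E \<rightarrow>\<^sub>E UNIV.
     (\<forall>u\<in>V1. block E c u \<in> C1) \<and> (\<forall>v\<in>V2. block E c v \<in> C2)}"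

text \<open>
  The map \<open>\<psi>\<^sub>\<E>\<close> and the code \<open>(C)\<^sub>\<Phi>\<close>; here \<open>\<Phi> = carrier_vec k\<close>, and words of length \<open>n\<close> over \<open>\<Phi>\<close>
  are extensional functions on \<open>V1\<close>.
\<close>

definition psi ::
  "'v::linorder set \<Rightarrow> 'v set set \<Rightarrow> nat \<Rightarrow> ('f vec \<Rightarrow> 'f vec) \<Rightarrow> ('v set \<Rightarrow> 'f) \<Rightarrow> 'v \<Rightarrow> 'f vec" where
  "psi V1 E k enc c = (\<lambda>u\<in>V1. inv_into (carrier_vec k) enc (block E c u))"

definition code_Phi ::
  "'v::linorder set \<Rightarrow> 'v set \<Rightarrow> 'v set set \<Rightarrow> 'f vec set \<Rightarrow> 'f vec set \<Rightarrow> nat \<Rightarrow>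
     ('f vec \<Rightarrow> 'f vec) \<Rightarrow> ('v \<Rightarrow> 'f vec) set" where
  "code_Phi V1 V2 E C1 C2 k enc = psi V1 E k enc ` graph_code V1 V2 E C1 C2"


text \<open>The erasure symbol is \<open>None\<close>.\<close>

definition num_erasures :: "'f option vec \<Rightarrow> nat" where
  "num_erasures w = card {i. i < dim_vec w \<and> w $ i = None}"

definition num_errors :: "'f option vec \<Rightarrow> 'f vec \<Rightarrow> nat" where
  "num_errors w c = card {i. i < dim_vec w \<and> w $ i \<noteq> None \<and> w $ i \<noteq> Some (c $ i)}"

definition error_decoder :: "nat \<Rightarrow> 'f vec set \<Rightarrow> real \<Rightarrow> ('f vec \<Rightarrow> 'f vec) \<Rightarrow> bool" where
  "error_decoder N C \<tau> D \<longleftrightarrow>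
     (\<forall>w\<in>carrier_vec N. D w \<in> C) \<and>
     (\<forall>w\<in>carrier_vec N. \<forall>c\<in>C. real (hamming_dist w c) < \<tau> \<longrightarrow> D w = c)"

definition error_erasure_decoder ::
  "nat \<Rightarrow> 'f vec set \<Rightarrow> real \<Rightarrow> ('f option vec \<Rightarrow> 'f vec) \<Rightarrow> bool" where
  "error_erasure_decoder N C \<tau> D \<longleftrightarrow>
     (\<forall>w\<in>carrier_vec N. D w \<in> C) \<and>
     (\<forall>w\<in>carrier_vec N. \<forall>c\<in>C.
        2 * real (num_errors w c) + real (num_erasures w) < \<tau> \<longrightarrow> D w = c)"


definition decoder_init ::
  "'v::linorder set \<Rightarrow> 'v set set \<Rightarrow> nat \<Rightarrow> ('f vec \<Rightarrow> 'f vec) \<Rightarrow> ('v \<Rightarrow> 'f vec option) \<Rightarrow>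
     'v set \<Rightarrow> 'f option" where
  "decoder_init V1 E \<Delta> enc y = word_of_blocks E V1
     (\<lambda>u. case y u of Some a \<Rightarrow> map_vec Some (enc a) | None \<Rightarrow> vec \<Delta> (\<lambda>_. None))"

text \<open>
  The first iteration (\<open>i = 2\<close>) leaves no erasures, so \<open>map_vec the\<close> in the odd steps is only ever
  applied to blocks without erasures.
\<close>

definition decoder_step ::
  "'v::linorder set \<Rightarrow> 'v set \<Rightarrow> 'v set set \<Rightarrow> ('f vec \<Rightarrow> 'f vec) \<Rightarrow> ('f option vec \<Rightarrow> 'f vec) \<Rightarrow>
     int \<Rightarrow> ('v set \<Rightarrow> 'f option) \<Rightarrow> 'v set \<Rightarrow> 'f option" where
  "decoder_step V1 V2 E D1 D2 i z =
     (if odd i then word_of_blocks E V1 (\<lambda>u. map_vec Some (D1 (map_vec the (block E z u))))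
      else word_of_blocks E V2 (\<lambda>v. map_vec Some (D2 (block E z v))))"

text \<open>The loop \<open>i = 2, 3, \<dots>, \<nu>\<close> is empty if \<open>\<nu> < 2\<close>.  The result \<open>None\<close> stands for ``error''.\<close>

definition iterative_decoder ::
  "'v::linorder set \<Rightarrow> 'v set \<Rightarrow> 'v set set \<Rightarrow> nat \<Rightarrow> 'f vec set \<Rightarrow> 'f vec set \<Rightarrow> nat \<Rightarrow>
     ('f vec \<Rightarrow> 'f vec) \<Rightarrow> ('f vec \<Rightarrow> 'f vec) \<Rightarrow> ('f option vec \<Rightarrow> 'f vec) \<Rightarrow> int \<Rightarrow>
     ('v \<Rightarrow> 'f vec option) \<Rightarrow> ('v \<Rightarrow> 'f vec) option" where
  "iterative_decoder V1 V2 E \<Delta> C1 C2 k enc D1 D2 \<nu> y =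
     (let z = fold (decoder_step V1 V2 E D1 D2) [2..\<nu>] (decoder_init V1 E \<Delta> enc y);
          c = (\<lambda>e\<in>E. the (z e))
      in if (\<forall>e\<in>E. z e \<noteq> None) \<and> c \<in> graph_code V1 V2 E C1 C2
         then Some (psi V1 E k enc c) else None)"


lemma bipartite_graph_sym: "bipartite_graph V1 V2 E \<Longrightarrow> bipartite_graph V2 V1 E"
  unfolding bipartite_graph_def by (simp add: Int_commute) (metis insert_commute)

text \<open>For the side \<open>V2\<close>, combine the next lemma with the previous one.\<close>

lemma block_word_of_blocks:
  assumes G: "bipartite_graph V1 V2 E" and u: "u \<in> V1"
    and b: "dim_vec (b u) = length (edges_at E u)"
  shows "block E (word_of_blocks E V1 b) u = b u"
proof -
  let ?N = "{w. {u, w} \<in> E}"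
  have fin: "finite ?N"
  proof (rule finite_subset)
    show "?N \<subseteq> V1 \<union> V2"
    proof
      fix w assume "w \<in> ?N"
      then obtain a c where "a \<in> V1" "c \<in> V2" "{u, w} = {a, c}"
        using G unfolding bipartite_graph_def by blast
      then show "w \<in> V1 \<union> V2" by (auto simp: doubleton_eq_iff)
    qed
    show "finite (V1 \<union> V2)" using G unfolding bipartite_graph_def by blast
  qed
  have uniq: "(THE x. x \<in> V1 \<and> x \<in> e) = u" if "e \<in> E" "u \<in> e" for e
  proof (rule the_equality)
    show "u \<in> V1 \<and> u \<in> e" using u that by blast
    fix x assume x: "x \<in> V1 \<and> x \<in> e"
    obtain a c where e: "c \<in> V2" "e = {a, c}"
      using G \<open>e \<in> E\<close> unfolding bipartite_graph_def by blast
    have "V1 \<inter> V2 = {}" using G unfolding bipartite_graph_def by blast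
    then have "x = a" "u = a" using x u that(2) e by auto
    then show "x = u" by simp
  qed
  have dist: "distinct (edges_at E u)"
    unfolding edges_at_def distinct_map
    by (intro conjI distinct_sorted_list_of_set inj_onI) (simp only: doubleton_eq_iff, blast)
  have mem: "edges_at E u ! i \<in> E \<and> u \<in> edges_at E u ! i" if "i < length (edges_at E u)" for i
  proof -
    have "edges_at E u ! i \<in> set (edges_at E u)" by (rule nth_mem[OF that])
    also have "\<dots> = (\<lambda>w. {u, w}) ` ?N" by (simp add: edges_at_def fin)
    finally show ?thesis by (elim imageE) simp
  qed
  have pos: "(THE j. j < length (edges_at E u) \<and> edges_at E u ! j = edges_at E u ! i) = i"
    if "i < length (edges_at E u)" for i
    using that nth_eq_iff_index_eq[OF dist] by (intro the_equality) blast+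
  show ?thesis
  proof (rule eq_vecI)
    show "dim_vec (block E (word_of_blocks E V1 b) u) = dim_vec (b u)"
      by (simp add: block_def b del: vec_of_list_map)
    fix i assume "i < dim_vec (b u)"
    then have i: "i < length (edges_at E u)" using b by simp
    then show "block E (word_of_blocks E V1 b) u $ i = b u $ i"
      using mem[OF i] uniq[of "edges_at E u ! i"] pos[OF i]
      by (simp add: block_def vec_of_list_index word_of_blocks_def Let_def del: vec_of_list_map)
  qed
qed

end

theory Submission
  imports Defs "HOL-Analysis.Function_Topology"
begin

text \<open>
  Give an edge cost \<open>1\<close> if its symbol is wrong, \<open>1/2\<close> if it is erased and \<open>0\<close> if it is right; a local
  decoder can fail at a vertex only if the edges there have total cost at least half its designed
  distance.  By the expander mixing lemma, if \<open>s\<close> is the cost fraction on one side and \<open>\<tau>\<close> is the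
  fraction of vertices failing next on the other side, then
  \<open>a \<tau> \<le> (1 - \<gamma>) s \<tau> + \<gamma> sqrt (s \<tau>)\<close> with \<open>a\<close> equal to \<open>\<delta>/2\<close> or \<open>\<theta>/2\<close>.  Up to a factor
  \<open>sqrt (\<theta>/\<delta>)\<close> on one side, \<open>1 / sqrt s\<close> is therefore bounded below by an affine recurrence with ratio
  \<open>\<kappa> = sqrt (\<theta> \<delta>) / (2 \<gamma>) > 1\<close> and fixed point \<open>sqrt \<sigma> / \<beta>\<close>.  After \<open>\<nu> - 1\<close> rounds it exceeds
  \<open>sqrt n\<close>, which means that fewer than one vertex fails.

  If \<open>\<sigma> n < 1\<close>, the value of \<open>\<nu>\<close> may be a junk value of the logarithm, but then the hypotheses
  leave no errors and no erasures at all.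
\<close>

section \<open>Linear codes and their encoders\<close>

lemma card_carrier_vec_finite:
  "card (carrier_vec k :: 'a::finite vec set) = card (UNIV :: 'a set) ^ k"
proof -
  have "bij_betw (vec k) ({..<k} \<rightarrow>\<^sub>E (UNIV :: 'a set)) (carrier_vec k)"
  proof (rule bij_betwI[where g = "\<lambda>v. \<lambda>i\<in>{..<k}. v $ i"])
    show "(\<lambda>i\<in>{..<k}. vec k f $ i) = f" if "f \<in> {..<k} \<rightarrow>\<^sub>E (UNIV :: 'a set)" for f
      using that by (auto simp: fun_eq_iff restrict_def PiE_def extensional_def)
  qed auto
  then have "card (carrier_vec k :: 'a vec set) = card ({..<k} \<rightarrow>\<^sub>E (UNIV :: 'a set))"
    using bij_betw_same_card by metis
  then show ?thesis by (simp add: card_PiE)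
qed

lemma linear_code_carrier:
  assumes "linear_code N k d (C :: 'f::field vec set)"
  shows "C \<subseteq> carrier_vec N"
  using assms unfolding linear_code_def VectorSpace.subspace_def submodule_def
  by (auto simp: module_vec_simps)

lemma finite_vec_carrier: "finite (carrier_vec k :: 'a::finite vec set)"
  by (rule card_ge_0_finite) (simp add: card_carrier_vec_finite finite_UNIV_card_ge_0)

text \<open>Coefficient functions on a generating set of \<open>k\<close> vectors map onto
  \<open>C\<close>, and the bound is the number of such functions.\<close>

lemma card_linear_code_le:
  assumes C: "linear_code N k d (C :: 'f::{field,finite} vec set)"
  shows "card C \<le> card (UNIV :: 'f set) ^ k"
proof -
  let ?W = "(module_vec TYPE('f) N)\<lparr>carrier := C\<rparr>"
  have "vectorspace (class_ring :: 'f ring) ?W"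
    using vectorspace.subspace_is_vs[OF vec_vs] C unfolding linear_code_def by blast
  then interpret W: vectorspace "class_ring :: 'f ring" ?W .
  have finC: "finite C"
    using linear_code_carrier[OF C] finite_vec_carrier by (rule finite_subset)
  have "W.fin_dim"
    unfolding W.fin_dim_def
    using finC W.span_is_subset2[of C] W.in_own_span[of C] by (intro exI[of _ C]) auto
  \<comment> \<open>\<open>dim\<close> is the least size of a finite generating set, so the
    least-number principle supplies a generating set of exactly that size.\<close>
  then have "\<exists>m A. finite A \<and> card A = m \<and> A \<subseteq> carrier ?W \<and> W.gen_set A"
    unfolding W.fin_dim_def by blast
  then have "\<exists>A. finite A \<and> card A = W.dim \<and> A \<subseteq> carrier ?W \<and> W.gen_set A"
    unfolding W.dim_def by (rule LeastI_ex)
  then obtain B where B: "finite B" "card B = W.dim" "B \<subseteq> C" "W.span B = C"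
    by auto
  have k: "W.dim = k" using C unfolding linear_code_def by blast
  have "C \<subseteq> (\<lambda>a. W.lincomb a B) ` (B \<rightarrow>\<^sub>E (UNIV :: 'f set))"
  proof
    fix c assume "c \<in> C"
    then obtain a where "c = W.lincomb a B"
      using W.finite_span[of B] B by (force simp: class_ring_simps)
    also have "\<dots> = W.lincomb (restrict a B) B"
      using B by (intro W.lincomb_cong) (auto simp: class_ring_simps)
    finally show "c \<in> (\<lambda>a. W.lincomb a B) ` (B \<rightarrow>\<^sub>E UNIV)" by auto
  qed
  then have "card C \<le> card (B \<rightarrow>\<^sub>E (UNIV :: 'f set))"
    using B by (intro surj_card_le) (auto intro: finite_PiE)
  also have "\<dots> = card (UNIV :: 'f set) ^ k" using B k by (simp add: card_PiE)
  finally show ?thesis .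
qed

lemma hamming_dist_le: "hamming_dist v w \<le> dim_vec v"
proof -
  have "card {i. i < dim_vec v \<and> v $ i \<noteq> w $ i} \<le> card {..<dim_vec v}"
    by (rule card_mono) auto
  then show ?thesis by (simp add: hamming_dist_def)
qed

lemma linear_code_distance_le:
  assumes "linear_code N k d (C :: 'f::field vec set)"
  shows "d \<le> N"
proof -
  obtain v w where "v \<in> C" "hamming_dist v w = d"
    using assms unfolding linear_code_def by blast
  then show ?thesis using linear_code_carrier[OF assms] hamming_dist_le[of v w] by auto
qed

lemma linear_encoder_in_code:
  assumes "linear_encoder k N (C :: 'f::field vec set) enc" and "a \<in> carrier_vec k"
  shows "enc a \<in> C"
proof -
  have "mod_hom class_ring (module_vec TYPE('f) k) ((module_vec TYPE('f) N)\<lparr>carrier := C\<rparr>) enc"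
    using assms(1) unfolding linear_encoder_def linear_map_def by blast
  then show ?thesis
    using assms(2) unfolding mod_hom_def mod_hom_axioms_def module_hom_def
    by (auto simp: module_vec_simps)
qed

text \<open>By counting: the image of an injective encoder already has at least as many elements as
  a code of dimension \<open>k\<close> can have. Surjectivity is what makes \<open>psi\<close>
  invertible by \<open>enc\<close>.\<close>

lemma linear_encoder_surj:
  assumes enc: "linear_encoder k N (C :: 'f::{field,finite} vec set) enc"
    and C: "linear_code N k d C"
  shows "enc ` carrier_vec k = C"
proof (rule card_seteq)
  show "finite C"
    using linear_code_carrier[OF C] finite_vec_carrier by (rule finite_subset)
  show "enc ` carrier_vec k \<subseteq> C"
    using linear_encoder_in_code[OF enc] by blast
  have "card (enc ` carrier_vec k) = card (UNIV :: 'f set) ^ k"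
    using enc unfolding linear_encoder_def by (simp add: card_image card_carrier_vec_finite)
  then show "card C \<le> card (enc ` carrier_vec k)"
    using card_linear_code_le[OF C] by simp
qed


section \<open>Rayleigh quotients of symmetric matrices\<close>

text \<open>The Rayleigh quotient attains its maximum on the unit sphere of the invariant subspace
  \<open>W\<close>, and a maximiser is an eigenvector for the maximal value. Vectors are functions
  on the whole type that vanish off \<open>V\<close>, so compactness can be taken from the product
  topology.\<close>

lemma symmetric_form_max_eigenvector:
  fixes a :: "'v \<Rightarrow> 'v \<Rightarrow> real" and W :: "('v \<Rightarrow> real) set"
  assumes "finite V" and sym: "\<And>u v. a u v = a v u"
    and supp: "\<And>h u. h \<in> W \<Longrightarrow> u \<notin> V \<Longrightarrow> h u = 0"
    and "closed W"
    and lin: "\<And>g h s t. g \<in> W \<Longrightarrow> h \<in> W \<Longrightarrow> (\<lambda>u. s * g u + t * h u) \<in> W"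
    and inv: "\<And>h. h \<in> W \<Longrightarrow> (\<lambda>u. \<Sum>v\<in>V. a u v * h v) \<in> W"
    and h0: "h0 \<in> W" "h0 u0 \<noteq> 0"
  obtains \<mu> h where "h \<in> W" "\<exists>u. h u \<noteq> 0" "\<And>u. (\<Sum>v\<in>V. a u v * h v) = \<mu> * h u"
    "\<And>g. g \<in> W \<Longrightarrow> (\<Sum>u\<in>V. g u * (\<Sum>v\<in>V. a u v * g v)) \<le> \<mu> * (\<Sum>u\<in>V. (g u)\<^sup>2)"
proof -
  define A where "A = (\<lambda>h u. \<Sum>v\<in>V. a u v * h v)"
  define ip where "ip = (\<lambda>g h :: 'v \<Rightarrow> real. \<Sum>u\<in>V. g u * h u)"
  have ip_comm: "ip g h = ip h g" for g h
    by (simp add: ip_def mult.commute)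
  have ip_lin: "ip f (\<lambda>u. s * g u + t * h u) = s * ip f g + t * ip f h" for f g h s t
    by (simp add: ip_def sum.distrib sum_distrib_left algebra_simps)
  have A_lin: "A (\<lambda>u. s * g u + t * h u) = (\<lambda>u. s * A g u + t * A h u)" for g h s t
    by (simp add: A_def sum.distrib sum_distrib_left algebra_simps)
  have A_sym: "ip g (A h) = ip h (A g)" for g h
  proof -
    have "ip g (A h) = (\<Sum>u\<in>V. \<Sum>v\<in>V. g u * a u v * h v)"
      by (simp add: ip_def A_def sum_distrib_left mult.assoc)
    also have "\<dots> = (\<Sum>v\<in>V. \<Sum>u\<in>V. g u * a u v * h v)" by (rule sum.swap)
    also have "\<dots> = ip h (A g)"
      unfolding ip_def A_def sum_distrib_left
      by (intro sum.cong refl) (metis mult.assoc mult.commute sym)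
    finally show ?thesis .
  qed
  have ip_pos: "ip h h > 0" if h: "h \<in> W" "h u \<noteq> 0" for h u
  proof -
    have "u \<in> V" using supp[OF h(1), of u] h(2) by blast
    then show ?thesis
      unfolding ip_def using \<open>finite V\<close> h(2)
      by (intro sum_pos2[of _ u]) (auto simp flip: power2_eq_square)
  qed
  have AW: "A h \<in> W" if "h \<in> W" for h
    using inv[OF that] by (simp add: A_def)
  have cont: "continuous_on UNIV (\<lambda>h. h u :: real)" for u :: 'v
    by simp
  have cont_A: "continuous_on UNIV (\<lambda>h. ip h (A h))"
    unfolding ip_def A_def by (intro continuous_intros cont)
  define K where "K = W \<inter> {h. ip h h = 1}"
  \<comment> \<open>The unit sphere lies in a product of compact sets, which is compact by
    Tychonoff's theorem; the factors off \<open>V\<close> collapse to a point.\<close>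
  define B where "B = Pi\<^sub>E UNIV (\<lambda>u. if u \<in> V then {- 1..1 :: real} else {0})"
  have "compactin (product_topology (\<lambda>_. euclidean) UNIV) B"
    unfolding B_def compactin_PiE by auto
  then have "compact B" by (simp add: euclidean_product_topology)
  moreover have "closed K"
    unfolding K_def ip_def
    by (intro closed_Int \<open>closed W\<close> closed_Collect_eq continuous_intros cont)
  moreover have "K \<subseteq> B"
  proof
    fix h assume h: "h \<in> K"
    have "h u \<in> (if u \<in> V then {- 1..1} else {0})" for u
    proof (cases "u \<in> V")
      case True
      then have "h u * h u \<le> ip h h"
        unfolding ip_def using \<open>finite V\<close> by (intro member_le_sum) auto
      then have "(h u)\<^sup>2 \<le> 1" using h by (simp add: K_def power2_eq_square)
      then have "\<bar>h u\<bar> \<le> 1" by (simp add: abs_square_le_1)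
      with True show ?thesis by (simp add: abs_le_iff)
    next
      case False
      then show ?thesis using h supp by (auto simp: K_def)
    qed
    then show "h \<in> B" unfolding B_def by auto
  qed
  ultimately have "compact K"
    using compact_Int_closed[of B K] by (simp add: Int_absorb1)
  have scale: "(\<lambda>u. (1 / sqrt (ip g g)) * g u) \<in> K"
      "ip (\<lambda>u. (1 / sqrt (ip g g)) * g u) (A (\<lambda>u. (1 / sqrt (ip g g)) * g u)) = ip g (A g) / ip g g"
    if g: "g \<in> W" "g u \<noteq> 0" for g u
  proof -
    have pos: "ip g g > 0" by (rule ip_pos[OF g])
    define s where "s = 1 / sqrt (ip g g)"
    have s2: "s * s = 1 / ip g g" using pos by (simp add: s_def)
    have 1: "ip (\<lambda>u. s * g u) (\<lambda>u. s * f u) = s * s * ip g f" for f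
      by (simp add: ip_def sum_distrib_left algebra_simps)
    have 2: "A (\<lambda>u. s * g u) = (\<lambda>u. s * A g u)"
      using A_lin[of s g 0 g] by simp
    have "(\<lambda>u. s * g u) \<in> W" using lin[OF g(1) g(1), of s 0] by simp
    then show "(\<lambda>u. (1 / sqrt (ip g g)) * g u) \<in> K"
      using pos 1[of g] unfolding s_def[symmetric] by (simp add: K_def s2)
    show "ip (\<lambda>u. (1 / sqrt (ip g g)) * g u) (A (\<lambda>u. (1 / sqrt (ip g g)) * g u)) = ip g (A g) / ip g g"
      unfolding s_def[symmetric] 2 1 s2 by simp
  qed
  have "K \<noteq> {}" using scale(1)[OF h0] by blast
  then obtain h where h: "h \<in> K" and max: "\<And>g. g \<in> K \<Longrightarrow> ip g (A g) \<le> ip h (A h)"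
    using continuous_attains_sup[OF \<open>compact K\<close>, of "\<lambda>h. ip h (A h)"]
      continuous_on_subset[OF cont_A] by blast
  define \<mu> where "\<mu> = ip h (A h)"
  have hW: "h \<in> W" and hh: "ip h h = 1" using h by (auto simp: K_def)
  have le: "ip g (A g) \<le> \<mu> * ip g g" if g: "g \<in> W" for g
  proof (cases "\<exists>u. g u \<noteq> 0")
    case True
    then obtain u where u: "g u \<noteq> 0" by blast
    show ?thesis
      using max[OF scale(1)[OF g u]] scale(2)[OF g u] ip_pos[OF g u]
      by (simp add: \<mu>_def pos_divide_le_eq)
  next
    case False
    then show ?thesis by (simp add: ip_def)
  qed
  \<comment> \<open>The form \<open>\<mu> ip - ip A\<close> is nonnegative on \<open>W\<close> and vanishes at \<open>h\<close>, so \<open>h\<close> is in its kernel: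
    perturb \<open>h\<close> in the direction of \<open>y\<close>.\<close>
  define y where "y = (\<lambda>u. \<mu> * h u + (- 1) * A h u)"
  have yW: "y \<in> W" unfolding y_def by (intro lin hW AW)
  define q where "q = \<mu> * ip y y - ip y (A y)"
  have quad: "0 \<le> 2 * s * ip y y + s\<^sup>2 * q" for s
  proof -
    define g where "g = (\<lambda>u. 1 * h u + s * y u)"
    have "g \<in> W" unfolding g_def by (intro lin hW yW)
    from le[OF this] have "0 \<le> \<mu> * ip g g - ip g (A g)" by simp
    have r: "ip (\<lambda>u. 1 * h u + s * y u) f = ip h f + s * ip y f" for f
      using ip_lin[of f 1 h s y] by (simp add: ip_comm)
    have "ip g g = ip h h + s * ip h y + s * (ip y h + s * ip y y)"
      unfolding g_def r using ip_lin[of h 1 h s y] ip_lin[of y 1 h s y] by simp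
    then have gg: "ip g g = 1 + 2 * s * ip y h + s\<^sup>2 * ip y y"
      using hh ip_comm[of h y] by (simp add: algebra_simps power2_eq_square)
    have "ip g (A g) = ip h (A h) + s * ip h (A y) + s * (ip y (A h) + s * ip y (A y))"
      unfolding g_def r A_lin
      using ip_lin[of h 1 "A h" s "A y"] ip_lin[of y 1 "A h" s "A y"] by simp
    then have gAg: "ip g (A g) = \<mu> + 2 * s * ip y (A h) + s\<^sup>2 * ip y (A y)"
      using A_sym[of h y] by (simp add: algebra_simps power2_eq_square \<mu>_def)
    \<comment> \<open>By the choice of \<open>y\<close>, the term linear in \<open>s\<close> has
      twice the squared norm of \<open>y\<close> as its coefficient.\<close>
    have yy: "ip y y = \<mu> * ip y h - ip y (A h)"
      using ip_lin[of y \<mu> h "- 1" "A h"] unfolding y_def by simp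
    have "\<mu> * ip g g - ip g (A g) = 2 * s * (\<mu> * ip y h - ip y (A h)) + s\<^sup>2 * q"
      unfolding gg gAg q_def by (simp add: algebra_simps)
    then show ?thesis using \<open>0 \<le> \<mu> * ip g g - ip g (A g)\<close> yy by simp
  qed
  have "y u = 0" for u
  proof (rule ccontr)
    assume "y u \<noteq> 0"
    then have pos: "ip y y > 0" by (rule ip_pos[OF yW])
    \<comment> \<open>A negative \<open>s\<close> this small lets the linear term outweigh the
      quadratic one: the latter is at most \<open>- s * ip y y\<close>, half the size of the
      former.\<close>
    define s where "s = - ip y y / (\<bar>q\<bar> + 1)"
    have "s < 0" using pos by (simp add: s_def divide_neg_pos)
    have "s\<^sup>2 * q \<le> s\<^sup>2 * (\<bar>q\<bar> + 1)" by (intro mult_left_mono) auto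
    also have "\<dots> = - s * ip y y" by (simp add: s_def power2_eq_square)
    finally have "0 \<le> s * ip y y" using quad[of s] by simp
    then show False using pos \<open>s < 0\<close> by (simp add: zero_le_mult_iff)
  qed
  then have eig: "A h u = \<mu> * h u" for u
    by (simp add: y_def)
  have "\<exists>u. h u \<noteq> 0"
    using hh by (auto simp: ip_def intro: ccontr)
  then show ?thesis
    using that[of h \<mu>] hW eig le by (simp add: A_def ip_def power2_eq_square)
qed


section \<open>The second eigenvalue of a regular bipartite graph\<close>

text \<open>The entry \<open>x\<close> precedes \<open>y\<close>, so it is not in the last position.
  With \<open>y\<close> the degree of the graph, this places a smaller eigenvalue at or below the
  second largest one without any discussion of multiplicities.\<close>

lemma nth_1_rev_sorted_ge:
  fixes xs :: "real list"
  assumes "sorted xs" "x \<in> set xs" "y \<in> set xs" "x < y"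
  shows "x \<le> rev xs ! 1"
proof -
  obtain i where i: "i < length xs" "xs ! i = x"
    using assms(2) by (auto simp: in_set_conv_nth)
  obtain j where j: "j < length xs" "xs ! j = y"
    using assms(3) by (auto simp: in_set_conv_nth)
  have "i < j"
    using sorted_nth_mono[OF assms(1), of j i] i j assms(4) by (cases "i < j") auto
  then have "xs ! i \<le> xs ! (length xs - 2)"
    using j by (intro sorted_nth_mono[OF assms(1)]) auto
  then show ?thesis
    using i j \<open>i < j\<close> by (simp add: rev_nth numeral_2_eq_2)
qed

text \<open>Read along the fixed ordering of \<open>V\<close>, the function \<open>h\<close> becomes
  an eigenvector of the matrix. The characteristic polynomial is monic, hence nonzero, so
  \<open>proots\<close> really contains its root \<mu>.\<close>

lemma graph_spectrum_memI:
  fixes h :: "'v::linorder \<Rightarrow> real"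
  assumes "finite V" and u0: "u0 \<in> V" "h u0 \<noteq> 0"
    and eig: "\<And>u. u \<in> V \<Longrightarrow> (\<Sum>v\<in>V. of_bool ({u, v} \<in> E) * h v) = \<mu> * h u"
  shows "\<mu> \<in> set (sorted_list_of_multiset (proots (char_poly (adj_matrix V E))))"
proof -
  let ?l = "sorted_list_of_set V" and ?n = "card V" and ?A = "adj_matrix V E"
  have A: "?A \<in> carrier_mat ?n ?n" by (simp add: adj_matrix_def)
  have len: "length ?l = ?n" and set: "set ?l = V" and dist: "distinct ?l"
    using \<open>finite V\<close> by auto
  have bij: "bij_betw ((!) ?l) {0..<?n} V"
    using bij_betw_nth[OF dist, of "{0..<?n}" V] len set by (auto simp: lessThan_atLeast0)
  define x where "x = vec ?n (\<lambda>i. h (?l ! i))"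
  have x: "x \<in> carrier_vec ?n" by (simp add: x_def)
  obtain i where i: "i < ?n" "?l ! i = u0"
    using u0 set len by (metis in_set_conv_nth)
  then have "x $ i \<noteq> 0" using u0 by (simp add: x_def)
  then have "x \<noteq> 0\<^sub>v ?n" using i by auto
  moreover have "?A *\<^sub>v x = \<mu> \<cdot>\<^sub>v x"
  proof (rule eq_vecI)
    show "dim_vec (?A *\<^sub>v x) = dim_vec (\<mu> \<cdot>\<^sub>v x)" by (simp add: adj_matrix_def x_def)
    fix j assume "j < dim_vec (\<mu> \<cdot>\<^sub>v x)"
    then have j: "j < ?n" by (simp add: x_def)
    then have jV: "?l ! j \<in> V" using set len nth_mem by metis
    have "(?A *\<^sub>v x) $ j = (\<Sum>k\<in>{0..<?n}. ?A $$ (j, k) * x $ k)"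
      using j A x by (auto simp: scalar_prod_def intro!: sum.cong)
    also have "\<dots> = (\<Sum>k\<in>{0..<?n}. of_bool ({?l ! j, ?l ! k} \<in> E) * h (?l ! k))"
      using j by (intro sum.cong) (simp_all add: adj_matrix_def x_def)
    also have "\<dots> = (\<Sum>v\<in>V. of_bool ({?l ! j, v} \<in> E) * h v)"
      by (rule sum.reindex_bij_betw[OF bij])
    also have "\<dots> = (\<mu> \<cdot>\<^sub>v x) $ j" using eig[OF jV] j by (simp add: x_def)
    finally show "(?A *\<^sub>v x) $ j = (\<mu> \<cdot>\<^sub>v x) $ j" .
  qed
  ultimately have "eigenvalue ?A \<mu>"
    unfolding eigenvalue_def eigenvector_def using x A by auto
  then have "poly (char_poly ?A) \<mu> = 0"
    using eigenvalue_root_char_poly[OF A] by simp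
  moreover have "char_poly ?A \<noteq> 0"
    using degree_monic_char_poly[OF A] by auto
  ultimately show ?thesis by simp
qed

section \<open>Neighbourhoods in a regular bipartite graph\<close>

lemma bipartite_edgeE:
  assumes "bipartite_graph U W E" "e \<in> E"
  obtains u w where "u \<in> U" "w \<in> W" "e = {u, w}"
  using assms unfolding bipartite_graph_def by blast

lemma bipartite_nbrs:
  assumes "bipartite_graph U W E" "u \<in> U" "{u, w} \<in> E"
  shows "w \<in> W"
proof -
  obtain a b where "a \<in> U" "b \<in> W" "{u, w} = {a, b}"
    using assms unfolding bipartite_graph_def by blast
  moreover have "U \<inter> W = {}" using assms(1) unfolding bipartite_graph_def by blast
  ultimately show ?thesis using assms(2) by (auto simp: doubleton_eq_iff)
qed

lemma finite_nbrs:
  assumes "bipartite_graph U W E" "u \<in> U"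
  shows "finite {w. {u, w} \<in> E}"
proof (rule finite_subset)
  show "{w. {u, w} \<in> E} \<subseteq> W" using bipartite_nbrs[OF assms] by blast
  show "finite W" using assms(1) unfolding bipartite_graph_def by blast
qed

lemma edge_atE:
  assumes "bipartite_graph U W E" "e \<in> E" "u \<in> U" "u \<in> e"
  obtains w where "w \<in> W" "e = {u, w}"
proof -
  obtain a b where ab: "a \<in> U" "b \<in> W" "e = {a, b}"
    using assms unfolding bipartite_graph_def by blast
  moreover have "U \<inter> W = {}" using assms(1) unfolding bipartite_graph_def by blast
  ultimately show ?thesis using that assms(3,4) by blast
qed

lemma card_nbrs:
  assumes G: "bipartite_graph U W E" and "regular_graph (U \<union> W) E \<Delta>" and u: "u \<in> U"
  shows "card {w. {u, w} \<in> E} = \<Delta>"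
proof -
  have "{e \<in> E. u \<in> e} = (\<lambda>w. {u, w}) ` {w. {u, w} \<in> E}"
    using edge_atE[OF G _ u] by blast
  moreover have "inj_on (\<lambda>w. {u, w}) {w. {u, w} \<in> E}"
    by (auto intro!: inj_onI simp: doubleton_eq_iff)
  ultimately have "card {e \<in> E. u \<in> e} = card {w. {u, w} \<in> E}"
    by (simp add: card_image)
  then show ?thesis using assms(2) u unfolding regular_graph_def by auto
qed

text \<open>Indicator sums suit exchanges of summation and the symmetric form; neighbour sums suit
  local counting. The second equation records that no edge joins two vertices of
  \<open>U\<close>.\<close>

lemma sum_adj_eq_sum_nbrs:
  fixes f :: "'v \<Rightarrow> real"
  assumes "bipartite_graph U W E" "u \<in> U"
  shows "(\<Sum>w\<in>W. of_bool ({u, w} \<in> E) * f w) = (\<Sum>w | {u, w} \<in> E. f w)"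
    and "(\<Sum>w\<in>U. of_bool ({u, w} \<in> E) * f w) = 0"
    and "(\<Sum>w\<in>U \<union> W. of_bool ({u, w} \<in> E) * f w) = (\<Sum>w | {u, w} \<in> E. f w)"
proof -
  have fin: "finite U" "finite W" "U \<inter> W = {}"
    using assms(1) unfolding bipartite_graph_def by blast+
  have "(\<Sum>w | {u, w} \<in> E. f w) = (\<Sum>w | {u, w} \<in> E. of_bool ({u, w} \<in> E) * f w)"
    by simp
  also have "\<dots> = (\<Sum>w\<in>W. of_bool ({u, w} \<in> E) * f w)"
    using bipartite_nbrs[OF assms] fin by (intro sum.mono_neutral_left) auto
  finally show 1: "(\<Sum>w\<in>W. of_bool ({u, w} \<in> E) * f w) = (\<Sum>w | {u, w} \<in> E. f w)" by simp
  show 2: "(\<Sum>w\<in>U. of_bool ({u, w} \<in> E) * f w) = 0"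
    using bipartite_nbrs[OF assms] fin by (intro sum.neutral) auto
  show "(\<Sum>w\<in>U \<union> W. of_bool ({u, w} \<in> E) * f w) = (\<Sum>w | {u, w} \<in> E. f w)"
    unfolding sum.union_disjoint[OF fin] 1 2 by simp
qed

text \<open>The side names are neutral because decoding rounds alternate between the sides: every
  result is used in both orientations, through \<open>swap_sides\<close>.\<close>

locale regular_bipartite =
  fixes U W :: "'v::linorder set" and E :: "'v set set" and \<Delta> n :: nat
  assumes G: "bipartite_graph U W E"
    and reg: "regular_graph (U \<union> W) E \<Delta>"
    and conn: "connected_graph (U \<union> W) E"
    and card_U: "card U = n" and card_W: "card W = n" and n_pos: "n > 0"
begin

lemma fin: "finite U" "finite W" and disj: "U \<inter> W = {}"
  using G unfolding bipartite_graph_def by blast+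

lemma swap_sides: "regular_bipartite W U E \<Delta> n"
  using G reg conn card_U card_W n_pos bipartite_graph_sym[of U W E]
  by unfold_locales (auto simp: Un_commute)

lemma sum_adj:
  fixes f :: "'v \<Rightarrow> real"
  assumes "u \<in> U \<union> W"
  shows "(\<Sum>w\<in>U \<union> W. of_bool ({u, w} \<in> E) * f w) = (\<Sum>w | {u, w} \<in> E. f w)"
  using assms sum_adj_eq_sum_nbrs(3)[OF G, of u f]
    sum_adj_eq_sum_nbrs(3)[OF bipartite_graph_sym[OF G], of u f]
  by (auto simp: Un_commute)

lemma nbrs_Un:
  assumes "u \<in> U \<union> W"
  shows "card {w. {u, w} \<in> E} = \<Delta>" "finite {w. {u, w} \<in> E}" "{w. {u, w} \<in> E} \<subseteq> U \<union> W"
  using assms card_nbrs[OF G reg, of u] finite_nbrs[OF G, of u] bipartite_nbrs[OF G, of u]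
    card_nbrs[OF bipartite_graph_sym[OF G], of \<Delta> u] finite_nbrs[OF bipartite_graph_sym[OF G], of u]
    bipartite_nbrs[OF bipartite_graph_sym[OF G], of u] reg
  by (auto simp: Un_commute)

text \<open>Maximum principle: for \<open>\<mu> = \<Delta>\<close> the maximum of \<open>h\<close> would spread along all edges.\<close>

lemma eigenvalue_less_degree:
  fixes h :: "'v \<Rightarrow> real"
  assumes u0: "u0 \<in> U \<union> W" "h u0 \<noteq> 0" and sum0: "(\<Sum>u\<in>U \<union> W. h u) = 0"
    and eig: "\<And>u. u \<in> U \<union> W \<Longrightarrow> (\<Sum>w | {u, w} \<in> E. h w) = \<mu> * h u"
  shows "\<mu> < real \<Delta>"
proof -
  let ?V = "U \<union> W"
  have finV: "finite ?V" using fin by simp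
  define M where "M = Max (h ` ?V)"
  have le: "h u \<le> M" if "u \<in> ?V" for u
    using that finV by (simp add: M_def)
  have "M \<in> h ` ?V" unfolding M_def using finV u0 by (intro Max_in) auto
  then obtain u1 where u1: "u1 \<in> ?V" "h u1 = M" by auto
  have "M > 0"
  proof (rule ccontr)
    assume "\<not> M > 0"
    then have "h u \<le> 0" if "u \<in> ?V" for u using le[OF that] by simp
    then have "(\<Sum>u\<in>?V. - h u) = 0 \<longleftrightarrow> (\<forall>u\<in>?V. - h u = 0)"
      by (intro sum_nonneg_eq_0_iff finV) auto
    then show False using sum0 u0 by (auto simp: sum_negf)
  qed
  \<comment> \<open>At a maximum vertex all these summands are nonnegative. Their sum therefore
    gives the sign of \<open>real \<Delta> - \<mu>\<close>, and if it is zero, every neighbour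
    attains the maximum as well.\<close>
  have nb: "(\<Sum>w | {u, w} \<in> E. M - h w) = (real \<Delta> - \<mu>) * M" if "u \<in> ?V" "h u = M" for u
    using eig[OF that(1)] nbrs_Un(1)[OF that(1)] that(2)
    by (simp add: sum_subtractf algebra_simps)
  have "\<mu> \<noteq> real \<Delta>"
  proof
    assume mu: "\<mu> = real \<Delta>"
    have nb_eq: "h w = M" if "u \<in> ?V" "h u = M" "{u, w} \<in> E" for u w
    proof -
      have "(\<Sum>w | {u, w} \<in> E. M - h w) = 0" using nb[OF that(1,2)] mu by simp
      moreover have "(\<Sum>w | {u, w} \<in> E. M - h w) = 0 \<longleftrightarrow> (\<forall>w\<in>{w. {u, w} \<in> E}. M - h w = 0)"
        using nbrs_Un(2,3)[OF that(1)] le by (intro sum_nonneg_eq_0_iff) auto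
      ultimately show ?thesis using that(3) by simp
    qed
    have "h w = M" if "w \<in> ?V" for w
    proof -
      have "(u1, w) \<in> {(a, b). {a, b} \<in> E}\<^sup>*"
        using conn u1 that unfolding connected_graph_def by blast
      then have "w \<in> ?V \<and> h w = M"
      proof induction
        case base
        show ?case using u1 by simp
      next
        case (step y z)
        then show ?case using nb_eq[of y z] nbrs_Un(3)[of y] by auto
      qed
      then show ?thesis by simp
    qed
    then have "(\<Sum>u\<in>?V. h u) = real (card ?V) * M" by simp
    then show False using sum0 \<open>M > 0\<close> u0 finV by (auto simp: card_eq_0_iff)
  qed
  moreover have "0 \<le> (real \<Delta> - \<mu>) * M"
  proof -
    have "0 \<le> (\<Sum>w | {u1, w} \<in> E. M - h w)"
      using nbrs_Un(3)[OF u1(1)] le by (intro sum_nonneg) auto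
    then show ?thesis using nb[OF u1] by simp
  qed
  then have "\<mu> \<le> real \<Delta>" using \<open>M > 0\<close> by (simp add: zero_le_mult_iff)
  ultimately show ?thesis by simp
qed

text \<open>Functions with sum zero on each side form an invariant subspace. Its top eigenvalue is
  below \<Delta> by connectedness, while \<Delta> is itself in the spectrum because of the constant
  function, so that eigenvalue is at most the second entry.\<close>

lemma quadratic_form_le:
  fixes g :: "'v \<Rightarrow> real"
  assumes \<Delta>: "\<Delta> > 0" and g: "\<And>u. u \<notin> U \<union> W \<Longrightarrow> g u = 0" "(\<Sum>u\<in>U. g u) = 0" "(\<Sum>u\<in>W. g u) = 0"
  shows "(\<Sum>u\<in>U \<union> W. g u * (\<Sum>w\<in>U \<union> W. of_bool ({u, w} \<in> E) * g w))
    \<le> graph_gamma (U \<union> W) E \<Delta> * real \<Delta> * (\<Sum>u\<in>U \<union> W. (g u)\<^sup>2)"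
proof (cases "\<exists>u0. g u0 \<noteq> 0")
  case False
  then show ?thesis by simp
next
  case True
  then obtain u0 where u0: "g u0 \<noteq> 0" by blast
  let ?V = "U \<union> W"
  define X where "X = {h :: 'v \<Rightarrow> real. (\<forall>u. u \<notin> ?V \<longrightarrow> h u = 0) \<and> (\<Sum>u\<in>U. h u) = 0 \<and> (\<Sum>u\<in>W. h u) = 0}"
  let ?a = "\<lambda>u w. of_bool ({u, w} \<in> E) :: real"
  have nin: "{u, w} \<notin> E" if "u \<notin> ?V" for u w
    using that G unfolding bipartite_graph_def by (auto simp: doubleton_eq_iff)
  \<comment> \<open>Summing over one side counts each vertex of the other side \<Delta> times, so
    sum zero is preserved. The sides are arbitrary here so that both orientations are
    covered.\<close>
  have inv: "(\<Sum>u\<in>U'. \<Sum>w\<in>?V. ?a u w * h w) = 0"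
    if "regular_bipartite U' W' E \<Delta> n" "?V = U' \<union> W'" "(\<Sum>w\<in>W'. h w) = 0" for U' W' h
  proof -
    interpret r: regular_bipartite U' W' E \<Delta> n by fact
    have "(\<Sum>u\<in>U'. \<Sum>w\<in>?V. ?a u w * h w) = (\<Sum>u\<in>U'. \<Sum>w\<in>W'. ?a u w * h w)"
      unfolding that(2)
      by (rule sum.cong[OF refl]) (simp only: sum_adj_eq_sum_nbrs[OF r.G])
    also have "\<dots> = (\<Sum>w\<in>W'. \<Sum>u\<in>U'. ?a u w * h w)" by (rule sum.swap)
    also have "\<dots> = (\<Sum>w\<in>W'. real \<Delta> * h w)"
    proof (intro sum.cong refl)
      fix w assume w: "w \<in> W'"
      have "(\<Sum>u\<in>U'. ?a w u * h w) = (\<Sum>u | {w, u} \<in> E. h w)"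
        by (rule sum_adj_eq_sum_nbrs(1)[OF bipartite_graph_sym[OF r.G] w])
      also have "\<dots> = real \<Delta> * h w" using r.nbrs_Un(1)[of w] w by simp
      finally show "(\<Sum>u\<in>U'. ?a u w * h w) = real \<Delta> * h w" by (simp add: insert_commute)
    qed
    finally show ?thesis using that(3) by (simp flip: sum_distrib_left)
  qed
  obtain \<mu> h where h: "h \<in> X" "\<exists>u. h u \<noteq> 0" "\<And>u. (\<Sum>v\<in>?V. ?a u v * h v) = \<mu> * h u"
    and le: "\<And>g. g \<in> X \<Longrightarrow> (\<Sum>u\<in>?V. g u * (\<Sum>v\<in>?V. ?a u v * g v)) \<le> \<mu> * (\<Sum>u\<in>?V. (g u)\<^sup>2)"
  proof (rule symmetric_form_max_eigenvector[of ?V ?a X g u0])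
    show "finite ?V" using fin by simp
    show "?a u v = ?a v u" for u v by (simp add: insert_commute)
    show "closed X"
    proof -
      have "X = (\<Inter>u\<in>- ?V. {h. h u = 0}) \<inter> {h. (\<Sum>u\<in>U. h u) = 0} \<inter> {h. (\<Sum>u\<in>W. h u) = 0}"
        by (auto simp: X_def)
      moreover have "closed \<dots>"
        by (intro closed_Int closed_INT ballI closed_Collect_eq continuous_intros
            continuous_on_product_coordinates)
      ultimately show ?thesis by simp
    qed
    show "(\<lambda>u. s * f u + t * h u) \<in> X" if "f \<in> X" "h \<in> X" for f h s t
      using that by (simp add: X_def sum.distrib flip: sum_distrib_left)
    show "(\<lambda>u. \<Sum>v\<in>?V. ?a u v * h v) \<in> X" if "h \<in> X" for h
      using that inv[OF regular_bipartite_axioms refl, of h] inv[OF swap_sides, of h] nin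
      by (auto simp: X_def Un_commute)
  qed (use g u0 in \<open>auto simp: X_def\<close>)
  obtain u1 where u1: "u1 \<in> ?V" "h u1 \<noteq> 0" using h(1,2) by (auto simp: X_def)
  have "(\<Sum>u\<in>?V. h u) = 0" using h(1) fin disj by (simp add: X_def sum.union_disjoint)
  then have less: "\<mu> < real \<Delta>"
    using u1 h(3) sum_adj[of _ h] by (intro eigenvalue_less_degree[of u1 h]) auto
  have finV: "finite ?V" using fin by simp
  have "\<mu> \<in> set (sorted_list_of_multiset (proots (char_poly (adj_matrix ?V E))))"
    by (rule graph_spectrum_memI[OF finV u1 h(3)])
  moreover have "real \<Delta> \<in> set (sorted_list_of_multiset (proots (char_poly (adj_matrix ?V E))))"
  proof (rule graph_spectrum_memI[OF finV u1(1), where h = "\<lambda>_. 1"])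
    show "(\<Sum>v\<in>?V. ?a u v * 1) = real \<Delta> * 1" if "u \<in> ?V" for u
      using sum_adj[OF that, of "\<lambda>_. 1"] nbrs_Un(1)[OF that] by simp
  qed simp
  ultimately have "\<mu> \<le> graph_spectrum ?V E ! 1"
    unfolding graph_spectrum_def by (intro nth_1_rev_sorted_ge[OF _ _ _ less]) auto
  then have "\<mu> \<le> graph_gamma ?V E \<Delta> * real \<Delta>" using \<Delta> by (simp add: graph_gamma_def)
  moreover have "g \<in> X" using g by (simp add: X_def)
  ultimately show ?thesis
    using le[of g] by (meson mult_right_mono order_trans sum_nonneg zero_le_power2)
qed

end


section \<open>The expander mixing lemma\<close>

context regular_bipartite
begin

text \<open>In a bipartite graph the quadratic form of a function glued from multiples of
  \<open>f\<close> and \<open>g\<close> is twice a multiple of the bilinear form, so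
  \<open>quadratic_form_le\<close> applies.\<close>

lemma bilinear_form_le:
  fixes f g :: "'v \<Rightarrow> real"
  assumes \<Delta>: "\<Delta> > 0" and f0: "(\<Sum>u\<in>U. f u) = 0" and g0: "(\<Sum>w\<in>W. g w) = 0"
  shows "(\<Sum>w\<in>W. g w * (\<Sum>u | {w, u} \<in> E. f u))
    \<le> graph_gamma (U \<union> W) E \<Delta> * real \<Delta> * (sqrt (\<Sum>u\<in>U. (f u)\<^sup>2) * sqrt (\<Sum>w\<in>W. (g w)\<^sup>2))"
    (is "?M \<le> ?l * _")
proof -
  define F where "F = sqrt (\<Sum>u\<in>U. (f u)\<^sup>2)"
  define H where "H = sqrt (\<Sum>w\<in>W. (g w)\<^sup>2)"
  have F2: "(\<Sum>u\<in>U. (f u)\<^sup>2) = F\<^sup>2" and H2: "(\<Sum>w\<in>W. (g w)\<^sup>2) = H\<^sup>2" and pos: "F \<ge> 0" "H \<ge> 0"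
    by (simp_all add: F_def H_def sum_nonneg)
  note swapped = bipartite_graph_sym[OF G]
  \<comment> \<open>The weights make both halves of \<open>h\<close> have the same norm, so that no loss occurs in
    passing from the quadratic to the bilinear form.\<close>
  define h where "h = (\<lambda>u. if u \<in> U then H * f u else if u \<in> W then F * g u else 0)"
  have hW: "h w = F * g w" if "w \<in> W" for w using that disj by (auto simp: h_def)
  have hU: "h u = H * f u" if "u \<in> U" for u using that by (auto simp: h_def)
  have M': "(\<Sum>u\<in>U. f u * (\<Sum>w | {u, w} \<in> E. g w)) = ?M"
  proof -
    have "(\<Sum>u\<in>U. f u * (\<Sum>w | {u, w} \<in> E. g w)) = (\<Sum>u\<in>U. f u * (\<Sum>w\<in>W. of_bool ({u, w} \<in> E) * g w))"
      by (rule sum.cong[OF refl]) (simp only: sum_adj_eq_sum_nbrs[OF G])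
    also have "\<dots> = (\<Sum>u\<in>U. \<Sum>w\<in>W. of_bool ({u, w} \<in> E) * f u * g w)"
      unfolding sum_distrib_left by (intro sum.cong refl) simp
    also have "\<dots> = (\<Sum>w\<in>W. \<Sum>u\<in>U. of_bool ({u, w} \<in> E) * f u * g w)" by (rule sum.swap)
    also have "\<dots> = (\<Sum>w\<in>W. g w * (\<Sum>u\<in>U. of_bool ({w, u} \<in> E) * f u))"
      unfolding sum_distrib_left by (intro sum.cong refl) (simp add: insert_commute)
    also have "\<dots> = ?M"
      by (rule sum.cong[OF refl]) (simp only: sum_adj_eq_sum_nbrs[OF swapped])
    finally show ?thesis .
  qed
  have "(\<Sum>u\<in>U \<union> W. h u * (\<Sum>w\<in>U \<union> W. of_bool ({u, w} \<in> E) * h w))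
      = (\<Sum>u\<in>U \<union> W. h u * (\<Sum>w | {u, w} \<in> E. h w))"
    by (rule sum.cong[OF refl]) (simp only: sum_adj)
  also have "\<dots> = (\<Sum>u\<in>U. H * f u * (\<Sum>w | {u, w} \<in> E. F * g w))
      + (\<Sum>w\<in>W. F * g w * (\<Sum>u | {w, u} \<in> E. H * f u))"
    unfolding sum.union_disjoint[OF fin disj]
    using bipartite_nbrs[OF G] bipartite_nbrs[OF swapped]
    by (intro arg_cong2[where f = "(+)"] sum.cong arg_cong2[where f = "(*)"])
      (auto simp: hU hW)
  also have "\<dots> = F * H * (\<Sum>u\<in>U. f u * (\<Sum>w | {u, w} \<in> E. g w)) + F * H * ?M"
    by (simp add: mult.assoc mult.left_commute flip: sum_distrib_left)
  finally have Q: "(\<Sum>u\<in>U \<union> W. h u * (\<Sum>w\<in>U \<union> W. of_bool ({u, w} \<in> E) * h w)) = 2 * (F * H) * ?M"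
    by (simp add: M')
  have N: "(\<Sum>u\<in>U \<union> W. (h u)\<^sup>2) = 2 * (F * H) * (F * H)"
    unfolding sum.union_disjoint[OF fin disj]
    by (simp add: hU hW power_mult_distrib F2 H2 flip: sum_distrib_left) (simp add: power2_eq_square)
  have "2 * (F * H) * ?M \<le> ?l * (2 * (F * H) * (F * H))"
    unfolding Q[symmetric] N[symmetric]
  proof (rule quadratic_form_le[OF \<Delta>])
    show "h u = 0" if "u \<notin> U \<union> W" for u using that by (simp add: h_def)
    show "(\<Sum>u\<in>U. h u) = 0" "(\<Sum>w\<in>W. h w) = 0"
      using f0 g0 by (simp_all add: hU hW flip: sum_distrib_left)
  qed
  show ?thesis
  proof (cases "F * H = 0")
    case False
    then have "F * H > 0" using pos by (simp add: less_le)
    moreover have "(F * H) * ?M \<le> (F * H) * (?l * (F * H))"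
      using \<open>2 * (F * H) * ?M \<le> ?l * (2 * (F * H) * (F * H))\<close> by (simp add: algebra_simps)
    ultimately have "?M \<le> ?l * (F * H)" using mult_le_cancel_left_pos by blast
    then show ?thesis by (simp add: F_def H_def)
  next
    \<comment> \<open>Cancelling \<open>F * H\<close> is impossible here, but one of the functions
      vanishes on its side and both sides of the inequality are zero.\<close>
    case True
    then consider "F = 0" | "H = 0" by auto
    then have "?M = 0"
    proof cases
      case 1
      then have "f u = 0" if "u \<in> U" for u
        using F2 fin that by (simp add: sum_nonneg_eq_0_iff)
      then show ?thesis using bipartite_nbrs[OF swapped] by (auto intro!: sum.neutral)
    next
      case 2
      then have "g w = 0" if "w \<in> W" for w
        using H2 fin that by (simp add: sum_nonneg_eq_0_iff)
      then show ?thesis by simp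
    qed
    moreover have "sqrt (\<Sum>u\<in>U. (f u)\<^sup>2) * sqrt (\<Sum>w\<in>W. (g w)\<^sup>2) = 0"
      using True by (simp only: F_def H_def)
    ultimately show ?thesis by (simp only: mult_zero_right)
  qed
qed

text \<open>Subtract the averages from \<chi> and from the indicator of \<open>T\<close>. The
  constant parts contribute the product of densities, and \<open>bilinear_form_le\<close> controls
  the centred parts. Fractional \<chi> is allowed because an erased vertex counts one half.\<close>

lemma expander_mixing:
  fixes \<chi> :: "'v \<Rightarrow> real"
  assumes \<Delta>: "\<Delta> > 0" and \<gamma>: "\<gamma> = graph_gamma (U \<union> W) E \<Delta>" "\<gamma> \<ge> 0"
    and \<chi>: "\<And>u. u \<in> U \<Longrightarrow> 0 \<le> \<chi> u \<and> \<chi> u \<le> 1" and T: "T \<subseteq> W"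
    and S: "S = (\<Sum>u\<in>U. \<chi> u)"
  shows "(\<Sum>w\<in>T. \<Sum>u | {w, u} \<in> E. \<chi> u)
    \<le> real \<Delta> * ((1 - \<gamma>) * (S * real (card T) / real n) + \<gamma> * sqrt (S * real (card T)))"
proof -
  let ?n = "real n" and ?t = "real (card T)"
  note swapped = bipartite_graph_sym[OF G]
  have n: "?n > 0" using n_pos by simp
  have finT: "finite T" using T fin finite_subset by blast
  have t: "?t \<le> ?n" "?t \<ge> 0" using card_mono[OF fin(2) T] card_W by auto
  have S01: "0 \<le> S" "S \<le> ?n"
    using sum_nonneg[of U \<chi>] sum_mono[of U \<chi> "\<lambda>_. 1"] \<chi> card_U by (auto simp: S)
  define f where "f = (\<lambda>u. \<chi> u - S / ?n)"
  define g where "g = (\<lambda>w. of_bool (w \<in> T) - ?t / ?n)"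
  have indT: "(\<Sum>w\<in>W. of_bool (w \<in> T) * k w) = (\<Sum>w\<in>T. k w)" for k :: "'v \<Rightarrow> real"
    using T fin by (simp add: Int_absorb2 Int_commute Int_absorb1)
  have cardT: "(\<Sum>w\<in>W. of_bool (w \<in> T)) = ?t"
    using indT[of "\<lambda>_. 1"] by simp
  have f0: "(\<Sum>u\<in>U. f u) = 0" using n by (simp add: f_def sum_subtractf card_U S)
  have g0: "(\<Sum>w\<in>W. g w) = 0" unfolding g_def sum_subtractf cardT using n by (simp add: card_W)
  have "(\<Sum>u\<in>U. (f u)\<^sup>2) = (\<Sum>u\<in>U. (\<chi> u)\<^sup>2) - 2 * (S / ?n) * S + ?n * (S / ?n)\<^sup>2"
  proof -
    have "(f u)\<^sup>2 = (\<chi> u)\<^sup>2 - 2 * (S / ?n) * \<chi> u + (S / ?n)\<^sup>2" for u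
      by (simp add: f_def power2_diff)
    then show ?thesis
      by (simp only: sum.distrib sum_subtractf flip: sum_distrib_left S) (simp add: card_U)
  qed
  also have "\<dots> = (\<Sum>u\<in>U. (\<chi> u)\<^sup>2) - S\<^sup>2 / ?n"
    using n by (simp add: power2_eq_square field_simps)
  \<comment> \<open>Values in the unit interval satisfy
    \<open>\<chi> u * \<chi> u \<le> \<chi> u\<close>, so fractional weights obey the same norm
    bound as indicators.\<close>
  also have "(\<Sum>u\<in>U. (\<chi> u)\<^sup>2) \<le> S"
    unfolding S using \<chi> by (intro sum_mono) (simp add: power2_eq_square mult_left_le)
  finally have F: "(\<Sum>u\<in>U. (f u)\<^sup>2) \<le> S * (1 - S / ?n)"
    by (simp add: power2_eq_square algebra_simps)
  have "(\<Sum>w\<in>W. (g w)\<^sup>2) = (\<Sum>w\<in>W. of_bool (w \<in> T) * (1 - 2 * (?t / ?n)) + (?t / ?n)\<^sup>2)"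
    by (intro sum.cong refl) (simp add: g_def power2_diff)
  also have "\<dots> = ?t * (1 - ?t / ?n)"
    unfolding sum.distrib indT using n by (simp add: card_W power2_eq_square field_simps)
  finally have H: "(\<Sum>w\<in>W. (g w)\<^sup>2) = ?t * (1 - ?t / ?n)" .
  define e where "e = (\<Sum>w\<in>T. \<Sum>u | {w, u} \<in> E. \<chi> u)"
  have sumW: "(\<Sum>w\<in>W. \<Sum>u | {w, u} \<in> E. \<chi> u) = real \<Delta> * S"
  proof -
    have "(\<Sum>w\<in>W. \<Sum>u | {w, u} \<in> E. \<chi> u) = (\<Sum>w\<in>W. \<Sum>u\<in>U. of_bool ({w, u} \<in> E) * \<chi> u)"
      by (rule sum.cong[OF refl]) (simp only: sum_adj_eq_sum_nbrs[OF swapped])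
    also have "\<dots> = (\<Sum>u\<in>U. \<Sum>w\<in>W. of_bool ({u, w} \<in> E) * \<chi> u)"
      by (subst sum.swap) (simp add: insert_commute)
    also have "\<dots> = (\<Sum>u\<in>U. \<Sum>w | {u, w} \<in> E. \<chi> u)"
      by (rule sum.cong[OF refl]) (simp only: sum_adj_eq_sum_nbrs[OF G])
    also have "\<dots> = real \<Delta> * S"
      using nbrs_Un(1) by (simp add: S sum_distrib_left)
    finally show ?thesis .
  qed
  have "(\<Sum>w\<in>W. g w * (\<Sum>u | {w, u} \<in> E. f u))
      = (\<Sum>w\<in>W. g w * ((\<Sum>u | {w, u} \<in> E. \<chi> u) - real \<Delta> * (S / ?n)))"
    using nbrs_Un(1) by (intro sum.cong refl) (simp add: f_def sum_subtractf)
  also have "\<dots> = (\<Sum>w\<in>W. g w * (\<Sum>u | {w, u} \<in> E. \<chi> u)) - (\<Sum>w\<in>W. g w) * (real \<Delta> * (S / ?n))"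
    by (simp only: right_diff_distrib sum_subtractf sum_distrib_right)
  also have "\<dots> = e - ?t / ?n * (real \<Delta> * S)"
    unfolding g0 by (simp only: g_def left_diff_distrib sum_subtractf indT sumW e_def
        flip: sum_distrib_left)
  finally have "e - ?t / ?n * (real \<Delta> * S)
      \<le> \<gamma> * real \<Delta> * (sqrt (\<Sum>u\<in>U. (f u)\<^sup>2) * sqrt (\<Sum>w\<in>W. (g w)\<^sup>2))"
    using bilinear_form_le[OF \<Delta> f0 g0] \<gamma> by simp
  also have "\<dots> \<le> \<gamma> * real \<Delta> * (sqrt (S * ?t) - S * ?t / ?n)"
  proof (intro mult_left_mono)
    let ?s = "S / ?n" and ?\<tau> = "?t / ?n"
    have sq: "(1 - q)\<^sup>2 - (1 - a) * (1 - b) = a + b - 2 * q" if "q\<^sup>2 = a * b" for q a b :: real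
      using that by (simp add: power2_diff algebra_simps)
    have st: "0 \<le> ?s" "0 \<le> ?\<tau>" "?s \<le> 1" "?\<tau> \<le> 1" using S01 t n by auto
    have "sqrt (\<Sum>u\<in>U. (f u)\<^sup>2) * sqrt (\<Sum>w\<in>W. (g w)\<^sup>2) \<le> sqrt (S * (1 - ?s)) * sqrt (?t * (1 - ?\<tau>))"
      unfolding H using F st t by (intro mult_right_mono) auto
    also have "\<dots> = sqrt (S * ?t) * sqrt ((1 - ?s) * (1 - ?\<tau>))"
      by (simp add: real_sqrt_mult)
    \<comment> \<open>After squaring, this is the inequality of arithmetic and geometric means for
      \<open>?s\<close> and \<open>?\<tau>\<close>.\<close>
    also have "sqrt ((1 - ?s) * (1 - ?\<tau>)) \<le> 1 - sqrt (?s * ?\<tau>)"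
    proof (rule real_le_lsqrt)
      show "0 \<le> 1 - sqrt (?s * ?\<tau>)" using mult_le_one[OF st(3,2,4)] by simp
      have "2 * sqrt (?s * ?\<tau>) \<le> ?s + ?\<tau>"
        using arith_geo_mean_sqrt[OF st(1,2)] by simp
      moreover have "(sqrt (?s * ?\<tau>))\<^sup>2 = ?s * ?\<tau>"
        using st by (intro real_sqrt_pow2 mult_nonneg_nonneg)
      then have "(1 - sqrt (?s * ?\<tau>))\<^sup>2 - (1 - ?s) * (1 - ?\<tau>) = ?s + ?\<tau> - 2 * sqrt (?s * ?\<tau>)"
        by (simp only: sq)
      ultimately show "(1 - ?s) * (1 - ?\<tau>) \<le> (1 - sqrt (?s * ?\<tau>))\<^sup>2" by linarith
    qed
    also have "sqrt (S * ?t) * (1 - sqrt (?s * ?\<tau>)) = sqrt (S * ?t) - S * ?t / ?n"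
      using S01 t n by (simp add: real_sqrt_mult real_sqrt_divide right_diff_distrib
          real_sqrt_mult_self flip: real_sqrt_mult)
    finally show "sqrt (\<Sum>u\<in>U. (f u)\<^sup>2) * sqrt (\<Sum>w\<in>W. (g w)\<^sup>2) \<le> sqrt (S * ?t) - S * ?t / ?n"
      using S01 t by (simp add: mult_left_mono)
  qed (use \<gamma> in auto)
  finally have *: "e - ?t / ?n * (real \<Delta> * S) \<le> \<gamma> * real \<Delta> * (sqrt (S * ?t) - S * ?t / ?n)" .
  define P where "P = S * ?t / ?n"
  have "?t / ?n * (real \<Delta> * S) = real \<Delta> * P" by (simp add: P_def)
  then show ?thesis
    using * unfolding e_def[symmetric] P_def[symmetric] by (simp add: algebra_simps)
qed

end


section \<open>The recurrence for the error fractions\<close>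

text \<open>
  The solution of \<open>L 0 = 1 / sqrt \<sigma>\<close>, \<open>L (j + 1) = \<kappa> * L j - (\<kappa> - 1) / \<beta> * sqrt \<sigma>\<close>.  The error
  fraction \<open>s\<close> after \<open>j\<close> rounds is bounded in the division-free form \<open>L j * sqrt s \<le> w\<close>, which also
  covers \<open>s = 0\<close>.
\<close>

definition error_potential :: "real \<Rightarrow> real \<Rightarrow> real \<Rightarrow> nat \<Rightarrow> real" where
  "error_potential \<kappa> \<beta> \<sigma> j = sqrt \<sigma> / \<beta> + \<kappa> ^ j * ((\<beta> - \<sigma>) / (\<beta> * sqrt \<sigma>))"

lemma error_potential_0:
  assumes "\<sigma> > 0" "\<beta> > 0"
  shows "error_potential \<kappa> \<beta> \<sigma> 0 = 1 / sqrt \<sigma>"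
proof -
  have "sqrt \<sigma> * sqrt \<sigma> = \<sigma>" using assms by simp
  then show ?thesis using assms by (simp add: error_potential_def field_simps)
qed

text \<open>The potential never falls below its initial value. Together with the invariant this
  gives the uniform bound \<open>sqrt s \<le> w * sqrt \<sigma>\<close> in every round.\<close>

lemma error_potential_ge:
  assumes "\<sigma> > 0" "\<sigma> < \<beta>" "\<kappa> \<ge> 1"
  shows "1 / sqrt \<sigma> \<le> error_potential \<kappa> \<beta> \<sigma> j"
proof -
  have "1 / sqrt \<sigma> = error_potential \<kappa> \<beta> \<sigma> 0"
    using assms by (simp add: error_potential_0)
  also have "\<dots> \<le> error_potential \<kappa> \<beta> \<sigma> j"
    unfolding error_potential_def using assms
    by (intro add_left_mono mult_right_mono) (auto simp: one_le_power)
  finally show ?thesis .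
qed

lemma error_potential_Suc:
  assumes "\<beta> \<noteq> 0"
  shows "error_potential \<kappa> \<beta> \<sigma> (Suc j)
    = \<kappa> * error_potential \<kappa> \<beta> \<sigma> j - (\<kappa> - 1) / \<beta> * sqrt \<sigma>"
  using assms by (simp add: error_potential_def field_simps)

text \<open>Divide the mixing inequality by \<open>sqrt \<tau>\<close> and multiply by the
  potential; the invariant then turns it into the affine recurrence. The hypotheses \<open>a\<close>
  and \<open>c\<close> balance the two kinds of round, so that a single recurrence serves
  both.\<close>

lemma error_potential_step:
  fixes \<kappa> \<beta> \<sigma> \<gamma> a s \<tau> w w' :: real
  assumes \<sigma>: "\<sigma> > 0" "\<sigma> < \<beta>" and \<kappa>: "\<kappa> > 1" and \<gamma>: "0 < \<gamma>" "\<gamma> < 1"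
    and w: "w > 0" "w' > 0" and a: "a * w' = \<kappa> * \<gamma> * w"
    and c: "(1 - \<gamma>) * (w * w') * \<beta> = \<gamma> * (\<kappa> - 1)"
    and s: "s \<ge> 0" and \<tau>: "\<tau> \<ge> 0"
    and mix: "a * \<tau> \<le> (1 - \<gamma>) * (s * \<tau>) + \<gamma> * sqrt (s * \<tau>)"
    and inv: "error_potential \<kappa> \<beta> \<sigma> j * sqrt s \<le> w"
  shows "error_potential \<kappa> \<beta> \<sigma> (Suc j) * sqrt \<tau> \<le> w'"
proof (cases "\<tau> = 0")
  case False
  define L where "L = error_potential \<kappa> \<beta> \<sigma> j"
  define p where "p = sqrt s"
  define q where "q = sqrt \<tau>"
  have q: "q > 0" "\<tau> = q * q" and p: "p \<ge> 0" "s = p * p" using False s \<tau> by (auto simp: p_def q_def)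
  have a_pos: "a > 0"
  proof -
    have "0 < a * w'" using \<kappa> \<gamma> w by (simp add: a)
    then show ?thesis using w(2) by (simp add: zero_less_mult_iff)
  qed
  have L: "L \<ge> 1 / sqrt \<sigma>" "L > 0"
    using error_potential_ge[OF \<sigma>, of \<kappa> j] \<kappa> \<sigma>(1)
    by (auto simp: L_def intro: less_le_trans[of 0 "1 / sqrt \<sigma>"])
  have "q * (a * q) \<le> q * ((1 - \<gamma>) * p\<^sup>2 * q + \<gamma> * p)"
    using mix p q by (simp add: algebra_simps power2_eq_square real_sqrt_mult)
  then have mix': "a * q \<le> (1 - \<gamma>) * p\<^sup>2 * q + \<gamma> * p" using q by simp
  have "p > 0"
  proof (rule ccontr)
    assume "\<not> p > 0"
    then have "p = 0" using p by simp
    then have "a * q \<le> 0" using mix' by simp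
    then show False using a_pos q by (simp add: mult_le_0_iff)
  qed
  have Lp: "L * p \<le> w" using inv by (simp add: L_def p_def)
  have "p \<le> w * sqrt \<sigma>"
  proof -
    have "1 / sqrt \<sigma> * p \<le> w" using mult_right_mono[OF L(1) p(1)] Lp by simp
    then show ?thesis using \<sigma>(1) by (simp add: field_simps)
  qed
  have "L * (a * q) \<le> (1 - \<gamma>) * (L * p) * p * q + \<gamma> * (L * p)"
    using mult_left_mono[OF mix', of L] L(2) by (simp add: algebra_simps power2_eq_square)
  \<comment> \<open>One factor \<open>p\<close> is absorbed by \<open>L * p \<le> w\<close>, the
    other receives the uniform bound. This replaces the quadratic term by the constant of the
    recurrence.\<close>
  also have "\<dots> \<le> (1 - \<gamma>) * w * (w * sqrt \<sigma>) * q + \<gamma> * w"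
    using Lp \<gamma> w p q \<sigma> \<open>p \<le> w * sqrt \<sigma>\<close> L(2)
    by (intro add_mono mult_mono mult_nonneg_nonneg) auto
  finally have "w' * (L * (a * q)) \<le> w' * ((1 - \<gamma>) * w * (w * sqrt \<sigma>) * q + \<gamma> * w)"
    using w by (intro mult_left_mono) auto
  then have "(a * w') * L * q \<le> ((1 - \<gamma>) * (w * w')) * w * sqrt \<sigma> * q + \<gamma> * w * w'"
    by (simp add: algebra_simps)
  also have "(1 - \<gamma>) * (w * w') = \<gamma> * (\<kappa> - 1) / \<beta>"
    using c \<sigma> by (simp add: field_simps)
  finally have "(\<gamma> * w) * ((\<kappa> * L - (\<kappa> - 1) / \<beta> * sqrt \<sigma>) * q) \<le> (\<gamma> * w) * w'"
    unfolding a by (simp add: algebra_simps diff_divide_distrib)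
  then show ?thesis
    using \<gamma> w \<sigma> by (simp add: error_potential_Suc L_def q_def)
qed (use w in simp)

text \<open>Multiplied by \<open>\<beta> * sqrt \<sigma>\<close>, the claim is the hypothesis
  \<open>X\<close> rearranged; this explains the argument of the logarithm in \<nu>.\<close>

lemma error_potential_gt:
  fixes \<kappa> \<beta> \<sigma> :: real and m n :: nat
  assumes \<sigma>: "\<sigma> > 0" "\<sigma> < \<beta>" and \<kappa>: "\<kappa> > 1"
    and X: "(\<beta> * sqrt (\<sigma> * real n) - \<sigma>) / (\<beta> - \<sigma>) < \<kappa> ^ m"
  shows "sqrt (real n) < error_potential \<kappa> \<beta> \<sigma> m"
proof -
  have sq: "sqrt \<sigma> * sqrt \<sigma> = \<sigma>" "sqrt \<sigma> > 0" using \<sigma> by auto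
  have "\<beta> * (sqrt \<sigma> * sqrt (real n)) - sqrt \<sigma> * sqrt \<sigma> < \<kappa> ^ m * (\<beta> - \<sigma>)"
    using X \<sigma> by (simp add: pos_divide_less_eq real_sqrt_mult)
  then have "\<beta> * sqrt \<sigma> * sqrt (real n) < sqrt \<sigma> * sqrt \<sigma> + \<kappa> ^ m * (\<beta> - \<sigma>)" by simp
  also have "\<dots> = \<beta> * sqrt \<sigma> * error_potential \<kappa> \<beta> \<sigma> m"
    using \<sigma> sq(2) by (simp add: error_potential_def field_simps)
  finally show ?thesis using \<sigma> sq(2) by simp
qed

text \<open>The base is the square of \<kappa>, so each unit of the logarithm pays for two rounds.
  The bound \<open>X \<ge> 1\<close> keeps the floor nonnegative, so that \<open>nat\<close> does
  not truncate.\<close>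

lemma less_power_floor_log:
  fixes \<kappa> X :: real
  assumes \<kappa>: "\<kappa> > 1" and X: "X \<ge> 1"
  shows "0 \<le> \<lfloor>log (\<kappa>\<^sup>2) X\<rfloor>" "X < \<kappa> ^ nat (2 * \<lfloor>log (\<kappa>\<^sup>2) X\<rfloor> + 2)"
proof -
  have k2: "\<kappa>\<^sup>2 > 1" using \<kappa> by (simp add: one_less_power)
  show nn: "0 \<le> \<lfloor>log (\<kappa>\<^sup>2) X\<rfloor>" using k2 X by simp
  define k where "k = nat \<lfloor>log (\<kappa>\<^sup>2) X\<rfloor>"
  have "log (\<kappa>\<^sup>2) X < real (Suc k)" using nn unfolding k_def by linarith
  then have "X < (\<kappa>\<^sup>2) powr real (Suc k)" using k2 X by (simp add: log_less_iff)
  also have "\<dots> = (\<kappa>\<^sup>2) ^ Suc k" using k2 \<kappa> by (intro powr_realpow) auto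
  also have "\<dots> = \<kappa> ^ nat (2 * \<lfloor>log (\<kappa>\<^sup>2) X\<rfloor> + 2)"
  proof -
    have "nat (2 * \<lfloor>log (\<kappa>\<^sup>2) X\<rfloor> + 2) = 2 * Suc k" using nn by (simp add: k_def nat_add_distrib nat_mult_distrib)
    then show ?thesis by (simp only: power_mult)
  qed
  finally show "X < \<kappa> ^ nat (2 * \<lfloor>log (\<kappa>\<^sup>2) X\<rfloor> + 2)" .
qed


section \<open>The local decoders\<close>

text \<open>Polymorphic in the symbols: it is applied to edge symbols over the field and also to
  received vertex symbols over \<Phi>.\<close>

definition edge_cost :: "'a option \<Rightarrow> 'a \<Rightarrow> real" where
  "edge_cost s a = (case s of None \<Rightarrow> 1 / 2 | Some b \<Rightarrow> of_bool (b \<noteq> a))"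

lemma edge_cost_simps [simp]:
  "edge_cost None a = 1 / 2" "edge_cost (Some b) a = of_bool (b \<noteq> a)"
  by (simp_all add: edge_cost_def)

lemma edge_cost_bounds: "0 \<le> edge_cost s a" "edge_cost s a \<le> 1"
  by (cases s; simp)+

lemma edge_cost_le_0_iff: "edge_cost s a \<le> 0 \<longleftrightarrow> s = Some a"
  by (cases s) auto

lemma dim_block [simp]: "dim_vec (block E z u) = length (edges_at E u)"
  by (simp add: block_def del: vec_of_list_map)

lemma block_index:
  "i < length (edges_at E u) \<Longrightarrow> block E z u $ i = z (edges_at E u ! i)"
  by (simp add: block_def vec_of_list_index del: vec_of_list_map)

lemma distinct_edges_at: "distinct (edges_at E u)"
  unfolding edges_at_def distinct_map
  by (intro conjI distinct_sorted_list_of_set inj_onI) (simp only: doubleton_eq_iff, blast)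

lemma card_index_eq_sum:
  fixes N :: nat
  shows "real (card {i. i < N \<and> P i}) = (\<Sum>i<N. of_bool (P i))"
proof -
  have "real (card {i. i < N \<and> P i}) = (\<Sum>i\<in>{i\<in>{..<N}. P i}. 1)" by simp
  also have "\<dots> = (\<Sum>i<N. of_bool (P i))"
    by (subst sum.inter_filter) (simp_all add: of_bool_def)
  finally show ?thesis .
qed

text \<open>The weights 1 and 1/2 are chosen to make the decoding condition on errors and erasures a
  bound on the total cost.\<close>

lemma twice_sum_edge_cost:
  fixes w :: "'a option vec" and c :: "'a vec"
  shows "2 * real (num_errors w c) + real (num_erasures w)
    = 2 * (\<Sum>i<dim_vec w. edge_cost (w $ i) (c $ i))"
proof -
  have "2 * of_bool (s \<noteq> None \<and> s \<noteq> Some a) + of_bool (s = None) = 2 * edge_cost s a"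
    for s :: "'a option" and a
    by (cases s) auto
  then show ?thesis
    unfolding num_errors_def num_erasures_def card_index_eq_sum sum_distrib_left
      sum.distrib[symmetric] by simp
qed

lemma hamming_dist_eq_sum_edge_cost:
  assumes "\<And>i. i < dim_vec w \<Longrightarrow> w $ i \<noteq> None"
  shows "real (hamming_dist (map_vec the w) c) = (\<Sum>i<dim_vec w. edge_cost (w $ i) (c $ i))"
proof -
  have "of_bool (map_vec the w $ i \<noteq> c $ i) = edge_cost (w $ i) (c $ i)" if "i < dim_vec w" for i
    using assms[OF that] that by auto
  then show ?thesis
    unfolding hamming_dist_def card_index_eq_sum by (auto intro!: sum.cong)
qed

section \<open>Edges at a vertex, blocks, and the fraction of failing vertices\<close>

context regular_bipartite
begin

lemma set_edges_at:
  assumes "u \<in> U \<union> W"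
  shows "set (edges_at E u) = (\<lambda>w. {u, w}) ` {w. {u, w} \<in> E}"
  using nbrs_Un(2)[OF assms] by (simp add: edges_at_def)

lemma length_edges_at:
  assumes "u \<in> U \<union> W"
  shows "length (edges_at E u) = \<Delta>"
  using nbrs_Un(1)[OF assms] by (simp add: edges_at_def)

lemma sum_edges_at:
  fixes f :: "'v set \<Rightarrow> real"
  assumes "u \<in> U \<union> W"
  shows "(\<Sum>i<\<Delta>. f (edges_at E u ! i)) = (\<Sum>w | {u, w} \<in> E. f {u, w})"
proof -
  have "(\<Sum>i<\<Delta>. f (edges_at E u ! i)) = (\<Sum>e\<in>set (edges_at E u). f e)"
    using sum.reindex_bij_betw[OF bij_betw_nth[OF distinct_edges_at refl refl], of f E u]
    by (simp add: length_edges_at[OF assms])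
  also have "\<dots> = (\<Sum>w | {u, w} \<in> E. f {u, w})"
    unfolding set_edges_at[OF assms]
    by (subst sum.reindex) (auto intro!: inj_onI simp: doubleton_eq_iff)
  finally show ?thesis .
qed

lemma edge_in_edges_at:
  assumes u: "u \<in> U \<union> W" and e: "e \<in> E" "u \<in> e"
  obtains i where "i < \<Delta>" "e = edges_at E u ! i"
proof -
  obtain w where "e = {u, w}"
    using u e edge_atE[OF G e(1) _ e(2)] edge_atE[OF bipartite_graph_sym[OF G] e(1) _ e(2)]
    by blast
  then have "e \<in> set (edges_at E u)" using set_edges_at[OF u] e(1) by auto
  then show ?thesis using that length_edges_at[OF u] by (auto simp: in_set_conv_nth)
qed

lemma word_of_blocks_edge:
  assumes u: "u \<in> U" and b: "dim_vec (b u) = \<Delta>" and e: "e \<in> E" "u \<in> e"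
  obtains i where "i < \<Delta>" "e = edges_at E u ! i" "word_of_blocks E U b e = b u $ i"
proof -
  have u': "u \<in> U \<union> W" using u by simp
  obtain i where i: "i < \<Delta>" "e = edges_at E u ! i" by (rule edge_in_edges_at[OF u' e])
  have "block E (word_of_blocks E U b) u = b u"
    by (rule block_word_of_blocks[where b = b, OF G u]) (simp add: b length_edges_at[OF u'])
  then show ?thesis
    using that[OF i] i block_index[of i E u "word_of_blocks E U b"] length_edges_at[OF u'] by simp
qed

lemma word_of_blocks_codeword:
  assumes u: "u \<in> U" and b: "b u = map_vec Some (block E c u)" and e: "e \<in> E" "u \<in> e"
  shows "word_of_blocks E U b e = Some (c e)"
proof -
  have u': "u \<in> U \<union> W" using u by simp
  have "dim_vec (b u) = \<Delta>" by (simp add: b length_edges_at[OF u'])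
  then obtain i where "i < \<Delta>" "e = edges_at E u ! i" "word_of_blocks E U b e = b u $ i"
    by (rule word_of_blocks_edge[where b = b, OF u _ e])
  then show ?thesis using b length_edges_at[OF u'] by (simp add: block_index)
qed

text \<open>Each vertex of \<open>T\<close> sees cost at least \<open>a * real \<Delta>\<close>,
  since otherwise \<open>correct\<close> would apply, and each edge costs at most the value of
  \<chi> at its other endpoint. Mixing bounds the total from above.\<close>

lemma failed_fraction_le:
  fixes \<chi> :: "'v \<Rightarrow> real" and z z' :: "'v set \<Rightarrow> 'a option" and c :: "'v set \<Rightarrow> 'a"
  assumes \<Delta>: "\<Delta> > 0" and \<gamma>: "\<gamma> = graph_gamma (U \<union> W) E \<Delta>" "\<gamma> \<ge> 0"
    and \<chi>: "\<And>u. u \<in> U \<Longrightarrow> 0 \<le> \<chi> u \<and> \<chi> u \<le> 1"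
    and cost: "\<And>u e. u \<in> U \<Longrightarrow> e \<in> E \<Longrightarrow> u \<in> e \<Longrightarrow> edge_cost (z e) (c e) \<le> \<chi> u"
    and correct: "\<And>w e. w \<in> W \<Longrightarrow> (\<Sum>u | {w, u} \<in> E. edge_cost (z {w, u}) (c {w, u})) < a * real \<Delta>
      \<Longrightarrow> e \<in> E \<Longrightarrow> w \<in> e \<Longrightarrow> z' e = Some (c e)"
    and T: "T = {w \<in> W. \<exists>e\<in>E. w \<in> e \<and> z' e \<noteq> Some (c e)}"
    and s: "s = (\<Sum>u\<in>U. \<chi> u) / real n" and \<tau>: "\<tau> = real (card T) / real n"
  shows "a * \<tau> \<le> (1 - \<gamma>) * (s * \<tau>) + \<gamma> * sqrt (s * \<tau>)"
proof -
  let ?S = "\<Sum>u\<in>U. \<chi> u" and ?t = "real (card T)" and ?n = "real n"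
  have n: "?n > 0" using n_pos by simp
  have TW: "T \<subseteq> W" by (auto simp: T)
  have "a * real \<Delta> \<le> (\<Sum>u | {w, u} \<in> E. \<chi> u)" if "w \<in> T" for w
  proof -
    have w: "w \<in> W" using that TW by blast
    have "a * real \<Delta> \<le> (\<Sum>u | {w, u} \<in> E. edge_cost (z {w, u}) (c {w, u}))"
      using that correct[OF w] by (force simp: T)
    also have "\<dots> \<le> (\<Sum>u | {w, u} \<in> E. \<chi> u)"
      using bipartite_nbrs[OF bipartite_graph_sym[OF G] w] by (intro sum_mono cost) auto
    finally show ?thesis .
  qed
  then have "(\<Sum>w\<in>T. a * real \<Delta>) \<le> (\<Sum>w\<in>T. \<Sum>u | {w, u} \<in> E. \<chi> u)" by (rule sum_mono)
  also have "\<dots> \<le> real \<Delta> * ((1 - \<gamma>) * (?S * ?t / ?n) + \<gamma> * sqrt (?S * ?t))"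
    by (rule expander_mixing[OF \<Delta> \<gamma> \<chi> TW refl])
  finally have "real \<Delta> * (a * ?t) \<le> real \<Delta> * ((1 - \<gamma>) * (?S * ?t / ?n) + \<gamma> * sqrt (?S * ?t))"
    by (simp add: algebra_simps)
  then have "a * ?t \<le> (1 - \<gamma>) * (?S * ?t / ?n) + \<gamma> * sqrt (?S * ?t)" using \<Delta> by simp
  then have "a * ?t / ?n \<le> ((1 - \<gamma>) * (?S * ?t / ?n) + \<gamma> * sqrt (?S * ?t)) / ?n"
    using n by (intro divide_right_mono) auto
  also have "\<dots> = (1 - \<gamma>) * (s * \<tau>) + \<gamma> * sqrt (s * \<tau>)"
  proof -
    have "sqrt (s * \<tau>) = sqrt (?S * ?t) / ?n"
      using n by (simp add: s \<tau> real_sqrt_mult real_sqrt_divide)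
    then show ?thesis using n by (simp add: s \<tau> add_divide_distrib)
  qed
  finally show ?thesis by (simp add: \<tau>)
qed

end

section \<open>Single rounds of the decoder, relative to a fixed codeword\<close>

locale graph_code_decoder = regular_bipartite V1 V2 E \<Delta> n
  for V1 V2 :: "'v::linorder set" and E \<Delta> n +
  fixes C1 C2 :: "'f::field vec set" and \<theta> \<delta> :: real
    and D1 :: "'f vec \<Rightarrow> 'f vec" and D2 :: "'f option vec \<Rightarrow> 'f vec"
    and c :: "'v set \<Rightarrow> 'f"
  assumes C1: "C1 \<subseteq> carrier_vec \<Delta>" and C2: "C2 \<subseteq> carrier_vec \<Delta>"
    and D1: "error_decoder \<Delta> C1 (\<theta> * real \<Delta> / 2) D1"
    and D2: "error_erasure_decoder \<Delta> C2 (\<delta> * real \<Delta>) D2"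
    and c: "c \<in> graph_code V1 V2 E C1 C2"
    and \<Delta>_pos: "\<Delta> > 0" and \<theta>_pos: "\<theta> > 0" and \<delta>_pos: "\<delta> > 0"
begin

interpretation swapped: regular_bipartite V2 V1 E \<Delta> n by (rule swap_sides)

lemma block_carrier:
  assumes "u \<in> V1 \<union> V2"
  shows "block E z u \<in> carrier_vec \<Delta>"
  using length_edges_at[OF assms] by (intro carrier_vecI) simp

text \<open>Both local decoders return codewords of full length, wrapped in \<open>Some\<close>, so
  a round leaves no erasure whatever its input was.\<close>

lemma decoder_step_total:
  assumes "e \<in> E"
  shows "decoder_step V1 V2 E D1 D2 i z e \<noteq> None"
proof -
  obtain u v where e: "u \<in> V1" "v \<in> V2" "e = {u, v}"
    using G assms unfolding bipartite_graph_def by blast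
  show ?thesis
  proof (cases "odd i")
    case True
    let ?b = "\<lambda>u. map_vec Some (D1 (map_vec the (block E z u)))"
    have "D1 (map_vec the (block E z u)) \<in> carrier_vec \<Delta>"
      using D1 C1 block_carrier[of u z] e unfolding error_decoder_def by auto
    then have dim: "dim_vec (?b u) = \<Delta>" by simp
    obtain i where "i < \<Delta>" "word_of_blocks E V1 ?b e = ?b u $ i"
      using word_of_blocks_edge[where b = ?b, OF e(1) dim assms] e by blast
    with True dim show ?thesis by (simp add: decoder_step_def)
  next
    case False
    let ?b = "\<lambda>u. map_vec Some (D2 (block E z u))"
    have "D2 (block E z v) \<in> carrier_vec \<Delta>"
      using D2 C2 block_carrier[of v z] e unfolding error_erasure_decoder_def by auto
    then have dim: "dim_vec (?b v) = \<Delta>" by simp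
    obtain i where "i < \<Delta>" "word_of_blocks E V2 ?b e = ?b v $ i"
      using swapped.word_of_blocks_edge[where b = ?b, OF e(2) dim assms] e by blast
    with False dim show ?thesis by (simp add: decoder_step_def)
  qed
qed

lemma sum_block_cost:
  assumes u: "u \<in> V1 \<union> V2"
  shows "(\<Sum>i<dim_vec (block E z u). edge_cost (block E z u $ i) (block E c u $ i))
    = (\<Sum>w | {u, w} \<in> E. edge_cost (z {u, w}) (c {u, w}))"
  using sum_edges_at[OF u, of "\<lambda>e. edge_cost (z e) (c e)"] length_edges_at[OF u]
  by (simp add: block_index)

lemma even_step_correct:
  assumes "even i" and v: "v \<in> V2" and e: "e \<in> E" "v \<in> e"
    and cost: "(\<Sum>w | {v, w} \<in> E. edge_cost (z {v, w}) (c {v, w})) < \<delta> / 2 * real \<Delta>"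
  shows "decoder_step V1 V2 E D1 D2 i z e = Some (c e)"
proof -
  have "block E c v \<in> C2" using c v by (simp add: graph_code_def)
  moreover have "2 * real (num_errors (block E z v) (block E c v))
      + real (num_erasures (block E z v)) < \<delta> * real \<Delta>"
    unfolding twice_sum_edge_cost using cost sum_block_cost[of v z] v by simp
  ultimately have "D2 (block E z v) = block E c v"
    using D2 block_carrier[of v z] v unfolding error_erasure_decoder_def by auto
  then show ?thesis
    using assms swapped.word_of_blocks_codeword[where b = "\<lambda>v. map_vec Some (D2 (block E z v))", OF v _ e]
    by (simp add: decoder_step_def)
qed

text \<open>Absence of erasures is assumed because \<open>map_vec the\<close> would turn them into
  unspecified symbols; the cost is then exactly the Hamming distance.\<close>

lemma odd_step_correct:
  assumes "odd i" and u: "u \<in> V1" and e: "e \<in> E" "u \<in> e" and z: "\<forall>e\<in>E. z e \<noteq> None"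
    and cost: "(\<Sum>w | {u, w} \<in> E. edge_cost (z {u, w}) (c {u, w})) < \<theta> / 2 * real \<Delta>"
  shows "decoder_step V1 V2 E D1 D2 i z e = Some (c e)"
proof -
  have u': "u \<in> V1 \<union> V2" using u by simp
  have "block E z u $ i \<noteq> None" if "i < dim_vec (block E z u)" for i
  proof -
    have "edges_at E u ! i \<in> set (edges_at E u)" using that by simp
    then have "edges_at E u ! i \<in> E" unfolding set_edges_at[OF u'] by auto
    then show ?thesis using z that by (simp add: block_index)
  qed
  then have "real (hamming_dist (map_vec the (block E z u)) (block E c u)) < \<theta> * real \<Delta> / 2"
    using cost sum_block_cost[OF u', of z] hamming_dist_eq_sum_edge_cost[of "block E z u"] by simp
  moreover have "block E c u \<in> C1" using c u by (simp add: graph_code_def)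
  ultimately have "D1 (map_vec the (block E z u)) = block E c u"
    using D1 block_carrier[OF u', of z] unfolding error_decoder_def by auto
  then show ?thesis
    using assms word_of_blocks_codeword[where b = "\<lambda>u. map_vec Some (D1 (map_vec the (block E z u)))", OF u _ e]
    by (simp add: decoder_step_def)
qed

text \<open>A correct word has cost zero at every vertex, below both positive thresholds. This
  settles inputs without errors or erasures for any number of rounds.\<close>

lemma decoder_step_codeword:
  assumes z: "\<forall>e\<in>E. z e = Some (c e)" and e: "e \<in> E"
  shows "decoder_step V1 V2 E D1 D2 i z e = Some (c e)"
proof -
  obtain u v where uv: "u \<in> V1" "v \<in> V2" "e = {u, v}"
    using G e unfolding bipartite_graph_def by blast
  have "(\<Sum>w | {x, w} \<in> E. edge_cost (z {x, w}) (c {x, w})) = 0" for x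
    using z by (intro sum.neutral) auto
  then show ?thesis
    using odd_step_correct[of i u e z] even_step_correct[of i v e z] uv e z \<Delta>_pos \<theta>_pos \<delta>_pos
    by (cases "odd i") auto
qed

lemma fold_decoder_step_codeword:
  assumes "\<forall>e\<in>E. z e = Some (c e)"
  shows "\<forall>e\<in>E. fold (decoder_step V1 V2 E D1 D2) is z e = Some (c e)"
  using assms by (induction "is" arbitrary: z) (simp_all add: decoder_step_codeword)

lemma iterative_decoder_codeword:
  assumes "\<forall>e\<in>E. fold (decoder_step V1 V2 E D1 D2) [2..\<nu>] (decoder_init V1 E \<Delta> enc y) e = Some (c e)"
  shows "iterative_decoder V1 V2 E \<Delta> C1 C2 k enc D1 D2 \<nu> y = Some (psi V1 E k enc c)"
proof -
  define z where "z = fold (decoder_step V1 V2 E D1 D2) [2..\<nu>] (decoder_init V1 E \<Delta> enc y)"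
  have "(\<lambda>e\<in>E. the (z e)) = c"
    using assms c unfolding z_def[symmetric] graph_code_def
    by (auto simp: fun_eq_iff restrict_def PiE_def extensional_def)
  then show ?thesis
    using assms c unfolding iterative_decoder_def Let_def z_def[symmetric] by simp
qed

text \<open>A wrong symbol over \<Phi> may spoil any edge at \<open>u\<close>, at cost at most 1; an
  erased one costs 1/2 on each edge; a correct one is encoded back to the block of
  \<open>c\<close>.\<close>

lemma decoder_init_cost:
  assumes enc: "enc ` carrier_vec k = C1" and y: "\<forall>u\<in>V1. \<forall>a. y u = Some a \<longrightarrow> a \<in> carrier_vec k"
    and u: "u \<in> V1" and e: "e \<in> E" "u \<in> e"
  shows "edge_cost (decoder_init V1 E \<Delta> enc y e) (c e) \<le> edge_cost (y u) (psi V1 E k enc c u)"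
proof (cases "y u")
  case None
  let ?b = "\<lambda>u. case y u of Some a \<Rightarrow> map_vec Some (enc a) | None \<Rightarrow> vec \<Delta> (\<lambda>_. None)"
  have "dim_vec (?b u) = \<Delta>" by (simp add: None)
  then obtain i where "i < \<Delta>" "word_of_blocks E V1 ?b e = ?b u $ i"
    using word_of_blocks_edge[where b = ?b, OF u _ e] by blast
  then show ?thesis by (simp add: None decoder_init_def)
next
  case (Some a)
  let ?b = "\<lambda>u. case y u of Some a \<Rightarrow> map_vec Some (enc a) | None \<Rightarrow> vec \<Delta> (\<lambda>_. None)"
  show ?thesis
  proof (cases "a = psi V1 E k enc c u")
    case True
    have "block E c u \<in> enc ` carrier_vec k" using c u enc by (simp add: graph_code_def)
    then have "enc a = block E c u" using u by (simp add: True psi_def f_inv_into_f)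
    then have "decoder_init V1 E \<Delta> enc y e = Some (c e)"
      using word_of_blocks_codeword[where b = ?b, OF u _ e] by (simp add: Some decoder_init_def)
    then show ?thesis by (simp add: edge_cost_bounds)
  next
    case False
    then show ?thesis by (simp add: Some edge_cost_bounds)
  qed
qed

end


section \<open>Iterated decoding\<close>

context graph_code_decoder
begin

interpretation swapped: regular_bipartite V2 V1 E \<Delta> n by (rule swap_sides)

text \<open>
  \<open>\<chi> u\<close> bounds the cost of every edge at \<open>u\<close> after \<open>m\<close> rounds, which are the rounds
  \<open>i = 2, \<dots>, m + 1\<close> of the decoder.
\<close>

lemma decoder_progress:
  fixes z0 :: "'v set \<Rightarrow> 'f option" and \<chi>0 :: "'v \<Rightarrow> real"
  defines "state \<equiv> (\<lambda>m. fold (decoder_step V1 V2 E D1 D2) [2..int m + 1] z0)"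
    and "side \<equiv> (\<lambda>m :: nat. if even m then V1 else V2)"
    and "weight \<equiv> (\<lambda>m :: nat. if even m then 1 else sqrt (\<theta> / \<delta>))"
  assumes \<gamma>: "\<gamma> = graph_gamma (V1 \<union> V2) E \<Delta>" "0 < \<gamma>" "\<gamma> < 1"
    and \<kappa>: "\<kappa> = sqrt (\<theta> * \<delta>) / (2 * \<gamma>)" "\<kappa> > 1"
    and \<beta>: "\<beta> = (\<delta> / 2 - \<gamma> * sqrt (\<delta> / \<theta>)) / (1 - \<gamma>)"
    and \<sigma>: "\<sigma> > 0" "\<sigma> < \<beta>"
    and \<chi>0: "\<And>u. u \<in> V1 \<Longrightarrow> 0 \<le> \<chi>0 u \<and> \<chi>0 u \<le> 1" "(\<Sum>u\<in>V1. \<chi>0 u) \<le> \<sigma> * real n"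
    and cost0: "\<And>u e. u \<in> V1 \<Longrightarrow> e \<in> E \<Longrightarrow> u \<in> e \<Longrightarrow> edge_cost (z0 e) (c e) \<le> \<chi>0 u"
  shows "\<exists>\<chi>. (\<forall>u\<in>side m. 0 \<le> \<chi> u \<and> \<chi> u \<le> 1 \<and> (m > 0 \<longrightarrow> \<chi> u \<in> {0, 1}))
    \<and> (\<forall>u\<in>side m. \<forall>e\<in>E. u \<in> e \<longrightarrow> edge_cost (state m e) (c e) \<le> \<chi> u)
    \<and> (m > 0 \<longrightarrow> (\<forall>e\<in>E. state m e \<noteq> None))
    \<and> error_potential \<kappa> \<beta> \<sigma> m * sqrt ((\<Sum>u\<in>side m. \<chi> u) / real n) \<le> weight m"
    (is "\<exists>\<chi>. ?P m \<chi>")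
proof (induction m)
  case 0
  have "(\<Sum>u\<in>V1. \<chi>0 u) / real n \<le> \<sigma>"
    using \<chi>0(2) n_pos by (simp add: pos_divide_le_eq)
  then have "sqrt ((\<Sum>u\<in>V1. \<chi>0 u) / real n) \<le> sqrt \<sigma>" by simp
  then have "error_potential \<kappa> \<beta> \<sigma> 0 * sqrt ((\<Sum>u\<in>V1. \<chi>0 u) / real n) \<le> 1"
    using \<sigma> by (simp add: error_potential_0 pos_divide_le_eq)
  then show ?case using \<chi>0(1) cost0
    by (intro exI[of _ \<chi>0]) (simp add: state_def side_def weight_def)
next
  case (Suc m)
  then obtain \<chi> where \<chi>: "?P m \<chi>" by blast
  define a where "a = (if even m then \<delta> / 2 else \<theta> / 2)"
  define T where "T = {w \<in> side (Suc m). \<exists>e\<in>E. w \<in> e \<and> state (Suc m) e \<noteq> Some (c e)}"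
  \<comment> \<open>\<open>state m\<close> ends with iteration \<open>m + 1\<close>, so the next
    index is \<open>m + 2\<close>, of the same parity as \<open>m\<close>: even \<open>m\<close> is
    followed by decoding at \<open>V2\<close>.\<close>
  have step: "state (Suc m) = decoder_step V1 V2 E D1 D2 (int m + 2) (state m)"
    unfolding state_def by (subst upto_rec2) (simp_all add: algebra_simps)
  have correct: "state (Suc m) e = Some (c e)"
    if "w \<in> side (Suc m)" "e \<in> E" "w \<in> e"
      "(\<Sum>u | {w, u} \<in> E. edge_cost (state m {w, u}) (c {w, u})) < a * real \<Delta>" for w e
  proof (cases "even m")
    case True
    then show ?thesis
      using even_step_correct[of "int m + 2" w e "state m"] that
      by (simp add: step side_def a_def)
  next
    case False
    then have "m > 0" by (cases m) auto
    with False show ?thesis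
      using odd_step_correct[of "int m + 2" w e "state m"] that \<chi>
      by (simp add: step side_def a_def)
  qed
  define \<tau> where "\<tau> = real (card T) / real n"
  define s where "s = (\<Sum>u\<in>side m. \<chi> u) / real n"
  have sides: "(side m = V1 \<and> side (Suc m) = V2) \<or> (side m = V2 \<and> side (Suc m) = V1)"
    by (simp add: side_def)
  have mix: "a * \<tau> \<le> (1 - \<gamma>) * (s * \<tau>) + \<gamma> * sqrt (s * \<tau>)"
    using sides
  proof (elim disjE conjE)
    assume sd: "side m = V1" "side (Suc m) = V2"
    show ?thesis
      by (rule failed_fraction_le[where \<chi> = \<chi> and z = "state m" and z' = "state (Suc m)" and c = c,
          OF \<Delta>_pos \<gamma>(1) _ _ _ _ T_def[unfolded sd] s_def[unfolded sd] \<tau>_def])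
        (use \<chi> correct \<gamma> sd in auto)
  next
    assume sd: "side m = V2" "side (Suc m) = V1"
    have \<gamma>': "\<gamma> = graph_gamma (V2 \<union> V1) E \<Delta>" using \<gamma>(1) by (simp add: Un_commute)
    show ?thesis
      by (rule swapped.failed_fraction_le[where \<chi> = \<chi> and z = "state m" and z' = "state (Suc m)" and c = c,
          OF \<Delta>_pos \<gamma>' _ _ _ _ T_def[unfolded sd] s_def[unfolded sd] \<tau>_def])
        (use \<chi> correct \<gamma> sd in auto)
  qed
  define w where "w = weight m"
  define w' where "w' = weight (Suc m)"
  \<comment> \<open>Writing \<theta> and \<delta> as squares makes the balance identities
    rational.\<close>
  define A where "A = sqrt \<theta>"
  define B where "B = sqrt \<delta>"
  have AB: "A > 0" "B > 0" "\<theta> = A * A" "\<delta> = B * B"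
    using \<theta>_pos \<delta>_pos by (auto simp: A_def B_def)
  have sq: "sqrt (\<theta> / \<delta>) = A / B" "sqrt (\<delta> / \<theta>) = B / A" "sqrt (\<theta> * \<delta>) = A * B"
    by (simp_all add: A_def B_def real_sqrt_mult real_sqrt_divide)
  have "error_potential \<kappa> \<beta> \<sigma> (Suc m) * sqrt \<tau> \<le> w'"
  proof (rule error_potential_step[OF \<sigma> \<kappa>(2) \<gamma>(2,3) _ _ _ _ _ _ mix])
    show "w > 0" "w' > 0" using AB by (auto simp: w_def w'_def weight_def sq)
    show "a * w' = \<kappa> * \<gamma> * w"
      unfolding a_def w_def w'_def weight_def \<kappa>(1) sq
      using AB \<gamma>(2) by (simp add: field_simps)
    \<comment> \<open>Here the formula for \<beta> enters: it matches the quadratic mixing term with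
      the constant of the recurrence. Consecutive weights have the same product in both kinds of
      round.\<close>
    have "(1 - \<gamma>) * \<beta> = \<delta> / 2 - \<gamma> * sqrt (\<delta> / \<theta>)"
      using \<gamma> by (simp add: \<beta>)
    moreover have "w * w' = A / B" by (simp add: w_def w'_def weight_def sq)
    ultimately have "(1 - \<gamma>) * (w * w') * \<beta> = (A / B) * (\<delta> / 2 - \<gamma> * sqrt (\<delta> / \<theta>))"
      by (metis mult.commute mult.assoc)
    also have "\<dots> = \<gamma> * (\<kappa> - 1)"
      unfolding \<kappa>(1) sq using AB \<gamma>(2) by (simp add: field_simps)
    finally show "(1 - \<gamma>) * (w * w') * \<beta> = \<gamma> * (\<kappa> - 1)" .
    show "s \<ge> 0" unfolding s_def using \<chi> by (intro divide_nonneg_nonneg sum_nonneg) auto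
    show "\<tau> \<ge> 0" by (simp add: \<tau>_def)
    show "error_potential \<kappa> \<beta> \<sigma> m * sqrt s \<le> w" using \<chi> by (simp add: s_def w_def)
  qed
  moreover have "(\<Sum>u\<in>side (Suc m). of_bool (u \<in> T)) = real (card T)"
  proof -
    have "finite (side (Suc m))" using fin by (simp add: side_def)
    moreover have "side (Suc m) \<inter> T = T" by (auto simp: T_def)
    ultimately show ?thesis by simp
  qed
  moreover have "edge_cost (state (Suc m) e) (c e) \<le> of_bool (u \<in> T)"
    if "u \<in> side (Suc m)" "e \<in> E" "u \<in> e" for u e
  proof (cases "u \<in> T")
    case False
    then show ?thesis using that by (auto simp: T_def)
  qed (simp add: edge_cost_bounds)
  moreover have "state (Suc m) e \<noteq> None" if "e \<in> E" for e
    unfolding step by (rule decoder_step_total[OF that])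
  ultimately show ?case
    \<comment> \<open>The new bound is the indicator of the failed vertices, whatever the fractional
      values were before.\<close>
    by (intro exI[of _ "\<lambda>u. of_bool (u \<in> T)"]) (simp add: \<tau>_def w'_def)
qed

end

section \<open>From the number of rounds to recovery of the codeword\<close>

theorem theorem4p1:
  fixes V1 V2 :: "'v::linorder set" and E :: "'v set set"
    and n \<Delta> :: nat
    and C1 C2 :: "'f::{field,finite} vec set"
    and k1 d1 k2 d2 :: nat
    and r \<theta> R \<delta> \<gamma> \<beta> \<sigma> :: real
    and enc :: "'f vec \<Rightarrow> 'f vec"
    and D1 :: "'f vec \<Rightarrow> 'f vec" and D2 :: "'f option vec \<Rightarrow> 'f vec"
    and \<nu> :: int
    and t \<rho> :: nat
    and x :: "'v \<Rightarrow> 'f vec" and y :: "'v \<Rightarrow> 'f vec option"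
  assumes "bipartite_graph V1 V2 E"
    and "regular_graph (V1 \<union> V2) E \<Delta>"
    and "connected_graph (V1 \<union> V2) E"
    and "card V1 = n" and "card V2 = n" and "n > 1"
    and "\<gamma> = graph_gamma (V1 \<union> V2) E \<Delta>"
    and "linear_code \<Delta> k1 d1 C1" and "real k1 = r * real \<Delta>" and "real d1 = \<theta> * real \<Delta>"
    and "linear_code \<Delta> k2 d2 C2" and "real k2 = R * real \<Delta>" and "real d2 = \<delta> * real \<Delta>"
    and "linear_encoder k1 \<Delta> C1 enc"
    and "error_decoder \<Delta> C1 (\<theta> * real \<Delta> / 2) D1"
    and "error_erasure_decoder \<Delta> C2 (\<delta> * real \<Delta>) D2"
    and "sqrt (\<theta> * \<delta>) > 2 * \<gamma>" and "2 * \<gamma> > 0"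
    and "\<beta> = (\<delta> / 2 - \<gamma> * sqrt (\<delta> / \<theta>)) / (1 - \<gamma>)"
    and "\<sigma> > 0" and "\<sigma> < \<beta>"
    and "\<nu> = 2 * \<lfloor>log ((\<theta> * \<delta>) / (4 * \<gamma>\<^sup>2))
                 ((\<beta> * sqrt (\<sigma> * real n) - \<sigma>) / (\<beta> - \<sigma>))\<rfloor> + 3"
    and "x \<in> code_Phi V1 V2 E C1 C2 k1 enc"
    and "\<forall>u\<in>V1. \<forall>a. y u = Some a \<longrightarrow> a \<in> carrier_vec k1"
    and "card {u\<in>V1. y u = None} = \<rho>"
    and "card {u\<in>V1. y u \<noteq> None \<and> y u \<noteq> Some (x u)} = t"
    and "real t + real \<rho> / 2 \<le> \<sigma> * real n"
    \<comment> \<open>excludes only a single erasure without errors when \<open>\<sigma> n < 1\<close>: there \<open>\<nu> < 2\<close> (or the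
        logarithm is undefined), and the decoder, making no iterations, cannot fill the erasure\<close>
    and "t = 0 \<and> \<rho> = 1 \<longrightarrow> 1 \<le> \<sigma> * real n"
  shows "iterative_decoder V1 V2 E \<Delta> C1 C2 k1 enc D1 D2 \<nu> y = Some x"
proof -
  note G = assms(1) and reg = assms(2) and conn = assms(3) and cards = assms(4,5) and n = \<open>n > 1\<close>
  have n0: "real n > 0" using n by simp
  have \<gamma>_pos: "\<gamma> > 0" and sqrt_gt: "sqrt (\<theta> * \<delta>) > 2 * \<gamma>" using assms by auto
  \<comment> \<open>Division by zero would give \<gamma> the value 0.\<close>
  have \<Delta>: "\<Delta> > 0"
  proof (rule ccontr)
    assume "\<not> \<Delta> > 0"
    then show False using \<gamma>_pos \<open>\<gamma> = graph_gamma (V1 \<union> V2) E \<Delta>\<close> by (simp add: graph_gamma_def)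
  qed
  have "0 \<le> \<theta> * real \<Delta>" "0 \<le> \<delta> * real \<Delta>"
    using \<open>real d1 = \<theta> * real \<Delta>\<close> \<open>real d2 = \<delta> * real \<Delta>\<close> by (metis of_nat_0_le_iff)+
  then have nonneg: "0 \<le> \<theta>" "0 \<le> \<delta>" using \<Delta> by (auto simp: zero_le_mult_iff)
  have "\<theta> * \<delta> \<noteq> 0" using sqrt_gt \<gamma>_pos by auto
  then have pos: "\<theta> > 0" "\<delta> > 0" using nonneg by (auto simp: less_le)
  \<comment> \<open>Distances are at most the length, so \<theta> and \<delta> are at most 1; the
    assumed gap then yields \<open>\<gamma> < 1\<close>.\<close>
  have "d1 \<le> \<Delta>" "d2 \<le> \<Delta>"
    using linear_code_distance_le assms(8) linear_code_distance_le assms(11) by blast+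
  then have "\<theta> * real \<Delta> \<le> 1 * real \<Delta>" "\<delta> * real \<Delta> \<le> 1 * real \<Delta>"
    using \<open>real d1 = \<theta> * real \<Delta>\<close> \<open>real d2 = \<delta> * real \<Delta>\<close> by (metis mult_1 of_nat_le_iff)+
  then have "\<theta> \<le> 1" "\<delta> \<le> 1" using \<Delta> by simp_all
  then have "sqrt (\<theta> * \<delta>) \<le> 1" using pos by (simp add: mult_le_one)
  then have \<gamma>1: "\<gamma> < 1" using sqrt_gt \<gamma>_pos by linarith
  obtain c where c: "c \<in> graph_code V1 V2 E C1 C2" and x: "x = psi V1 E k1 enc c"
    using \<open>x \<in> code_Phi V1 V2 E C1 C2 k1 enc\<close> unfolding code_Phi_def by blast
  interpret graph_code_decoder V1 V2 E \<Delta> n C1 C2 \<theta> \<delta> D1 D2 c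
  proof unfold_locales
    show "C1 \<subseteq> carrier_vec \<Delta>" "C2 \<subseteq> carrier_vec \<Delta>"
      using linear_code_carrier assms(8) linear_code_carrier assms(11) by blast+
  qed (use G reg conn cards n c pos \<Delta> assms(15,16) in auto)
  have enc: "enc ` carrier_vec k1 = C1"
    using linear_encoder_surj assms(8,14) by blast
  \<comment> \<open>The total of these vertex costs is exactly \<open>t + \<rho> / 2\<close>, the
    quantity bounded in the hypotheses.\<close>
  define \<chi> where "\<chi> = (\<lambda>u. edge_cost (y u) (x u))"
  have \<chi>01: "0 \<le> \<chi> u \<and> \<chi> u \<le> 1" for u by (simp add: \<chi>_def edge_cost_bounds)
  define z0 where "z0 = decoder_init V1 E \<Delta> enc y"
  have cost0: "edge_cost (z0 e) (c e) \<le> \<chi> u" if "u \<in> V1" "e \<in> E" "u \<in> e" for u e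
    using decoder_init_cost[OF enc assms(24) that] by (simp add: z0_def \<chi>_def x)
  have sum\<chi>: "(\<Sum>u\<in>V1. \<chi> u) = real t + real \<rho> / 2"
  proof -
    have "\<chi> u = of_bool (y u \<noteq> None \<and> y u \<noteq> Some (x u)) + of_bool (y u = None) / 2" for u
      by (cases "y u") (auto simp: \<chi>_def)
    then have "(\<Sum>u\<in>V1. \<chi> u) = (\<Sum>u\<in>V1. of_bool (y u \<noteq> None \<and> y u \<noteq> Some (x u)))
        + (\<Sum>u\<in>V1. of_bool (y u = None)) / 2"
      by (simp only: sum.distrib sum_divide_distrib)
    moreover have "(\<Sum>u\<in>V1. of_bool (P u)) = real (card {u\<in>V1. P u})" for P
      using fin by (simp add: Collect_conj_eq)
    ultimately show ?thesis using assms(25,26) by simp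
  qed
  have "\<forall>e\<in>E. fold (decoder_step V1 V2 E D1 D2) [2..\<nu>] z0 e = Some (c e)"
  proof (cases "\<sigma> * real n < 1")
    case True
    have "real t + real \<rho> / 2 < 1" using True assms(27) by linarith
    then have "t = 0 \<and> \<rho> \<le> 1" by linarith
    then have "t = 0 \<and> \<rho> = 0" using True assms(28) by linarith
    then have "(\<Sum>u\<in>V1. \<chi> u) = 0" using sum\<chi> by simp
    then have zero: "\<chi> u = 0" if "u \<in> V1" for u
      using that fin(1) \<chi>01 sum_nonneg_eq_0_iff[of V1 \<chi>] by blast
    have "z0 e = Some (c e)" if e: "e \<in> E" for e
    proof -
      obtain u v where "u \<in> V1" "v \<in> V2" "e = {u, v}"
        by (rule bipartite_edgeE[OF G e])
      then have u: "u \<in> V1" "u \<in> e" by simp_all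
      show ?thesis using cost0[OF u(1) e u(2)] zero[OF u(1)] by (simp add: edge_cost_le_0_iff)
    qed
    then show ?thesis by (intro fold_decoder_step_codeword) blast
  next
    case False
    define \<kappa> where "\<kappa> = sqrt (\<theta> * \<delta>) / (2 * \<gamma>)"
    define X where "X = (\<beta> * sqrt (\<sigma> * real n) - \<sigma>) / (\<beta> - \<sigma>)"
    have \<kappa>: "\<kappa> > 1" using sqrt_gt \<gamma>_pos by (simp add: \<kappa>_def)
    have \<kappa>2: "\<kappa>\<^sup>2 = (\<theta> * \<delta>) / (4 * \<gamma>\<^sup>2)"
      using pos by (simp add: \<kappa>_def power_divide power_mult_distrib)
    have \<sigma>: "\<sigma> > 0" "\<sigma> < \<beta>" by fact+
    have "\<beta> * 1 \<le> \<beta> * sqrt (\<sigma> * real n)"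
      using False \<sigma> by (intro mult_left_mono) auto
    then have X: "X \<ge> 1" using \<sigma> by (simp add: X_def)
    \<comment> \<open>This is the number \<open>\<nu> - 1\<close> of rounds. It is even, so the last
      round decodes at \<open>V1\<close>, where the weight is 1; it is positive, so the final bound
      takes only the values 0 and 1.\<close>
    define m where "m = nat (2 * \<lfloor>log (\<kappa>\<^sup>2) X\<rfloor> + 2)"
    have m: "\<nu> = int m + 1" "even m" "m > 0"
    proof -
      define l where "l = \<lfloor>log (\<kappa>\<^sup>2) X\<rfloor>"
      have l: "0 \<le> l" "\<nu> = 2 * l + 3" "m = nat (2 * l + 2)"
        using less_power_floor_log(1)[OF \<kappa> X] assms(22)
        by (simp_all only: l_def m_def \<kappa>2 X_def)
      then show "\<nu> = int m + 1" "even m" "m > 0" by (simp_all add: even_nat_iff)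
    qed
    have gt: "sqrt (real n) < error_potential \<kappa> \<beta> \<sigma> m"
      using error_potential_gt[OF \<sigma> \<kappa>, of n m] less_power_floor_log(2)[OF \<kappa> X]
      by (simp add: X_def m_def)
    have "(\<Sum>u\<in>V1. \<chi> u) \<le> \<sigma> * real n" using sum\<chi> assms(27) by simp
    from decoder_progress[OF assms(7) \<gamma>_pos \<gamma>1 \<kappa>_def \<kappa> assms(19) \<sigma> \<chi>01 this cost0, of m]
    obtain \<xi> where \<xi>: "\<And>u. u \<in> V1 \<Longrightarrow> \<xi> u \<in> {0, 1}"
      and cost: "\<And>u e. u \<in> V1 \<Longrightarrow> e \<in> E \<Longrightarrow> u \<in> e \<Longrightarrow>
        edge_cost (fold (decoder_step V1 V2 E D1 D2) [2..\<nu>] z0 e) (c e) \<le> \<xi> u"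
      and bound: "error_potential \<kappa> \<beta> \<sigma> m * sqrt ((\<Sum>u\<in>V1. \<xi> u) / real n) \<le> 1"
      using m by auto
    let ?S = "\<Sum>u\<in>V1. \<xi> u"
    have \<xi>_nonneg: "\<xi> u \<ge> 0" if "u \<in> V1" for u using \<xi>[OF that] by auto
    \<comment> \<open>A sum of at least 1 would make the square root at least
      \<open>1 / sqrt (real n)\<close>, and the potential exceeds \<open>sqrt (real n)\<close>. A
      sum of zeros and ones below 1 vanishes, so no edge is left wrong.\<close>
    have "?S < 1"
    proof (rule ccontr)
      assume "\<not> ?S < 1"
      then have "1 / sqrt (real n) \<le> sqrt (?S / real n)"
        using n0 by (simp add: real_sqrt_divide divide_right_mono)
      moreover have "sqrt (real n) > 0" using n0 by simp
      ultimately have "1 < error_potential \<kappa> \<beta> \<sigma> m * sqrt (?S / real n)"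
        using mult_less_le_imp_less[OF gt, of "1 / sqrt (real n)" "sqrt (?S / real n)"] by simp
      then show False using bound by simp
    qed
    have zero: "\<xi> u = 0" if "u \<in> V1" for u
    proof -
      have "\<xi> u \<le> ?S" using that \<xi>_nonneg fin by (intro member_le_sum) auto
      then show ?thesis using \<xi>[OF that] \<open>?S < 1\<close> by auto
    qed
    show ?thesis
    proof
      fix e assume e: "e \<in> E"
      obtain u v where "u \<in> V1" "v \<in> V2" "e = {u, v}"
        by (rule bipartite_edgeE[OF G e])
      then have u: "u \<in> V1" "u \<in> e" by simp_all
      show "fold (decoder_step V1 V2 E D1 D2) [2..\<nu>] z0 e = Some (c e)"
        using cost[OF u(1) e u(2)] zero[OF u(1)] by (simp add: edge_cost_le_0_iff)
    qed
  qed
  then show ?thesis unfolding z0_def x by (rule iterative_decoder_codeword)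
qed

end
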